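(* In each of the three settings (real, complex, quaternionic) described in the context, with Lie algebra $\mathfrak g$, $N=\dim\mathfrak g$, constant $\kappa$ and model tensor $R_1$, set $k_*=\frac{2\kappa}{3}$. There exists a nonzero admissible tensor $R_*$ such that the following hold. (a) There is an orthonormal eigenbasis $\eta_1,\dots,\eta_N$ of $R_*|_{\mathfrak g}$, ordered by nondecreasing eigenvalue, with $\sum_{i=1}^l\|\eta_i\cdot R_*\|^2=6l\|R_*\|^2$ for $l=1$ and $l=2$. (b) For every real $k$ with $k_*<k\le N$ and every $c$ with $\frac2k<c<\frac3\kappa$ (an interval which is nonempty), the algebraic curvature tensor $R_c=cR_1+R_*$ satisfies $$\Sigma_k(R_c|_{\mathfrak g})>0\qquad\text{and}\qquad Q(R_c,R_* )<0.$$ In the complex setting (respectively the quaternionic setting) the same is true with $\Sigma_k(R_c|_{\mathfrak g})$ replaced by $\Sigma_k$ of the full Kähler operator $R_c|_{\mathfrak u(n)}$ for $k_*<k\le N+1$ (respectively of the full quaternionic-Kähler operator $R_c|_{\mathfrak{sp}(n)\oplus\mathfrak{sp}(1)}$ for $k_*<k\le N+3$).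
   Context: Conventions. For a real inner product space $V$, $\bigwedge^2V$ carries $\langle x\wedge y,z\wedge w\rangle=\langle x,z\rangle\langle y,w\rangle-\langle x,w\rangle\langle y,z\rangle$ and is identified with $\mathfrak{so}(V)$ by $(x\wedge y)z=\langle x,z\rangle y-\langle y,z\rangle x$, so $\langle L,K\rangle=-\frac12\operatorname{tr}_{\mathbb R}(LK)$. An algebraic curvature tensor $C$ is identified with its curvature operator, the self-adjoint operator $\langle C(x\wedge y),z\wedge w\rangle=C(x,y,z,w)$, and satisfies the first Bianchi identity; its Ricci contraction is $\sum_iC(x,e_i,y,e_i)$. Settings. Real: $V=\mathbb R^n$, $n\ge4$, $\mathfrak g=\mathfrak{so}(n)$, $N=n(n-1)/2$, $\kappa=n-1$; $R_1=\operatorname{Id}$; admissible tensors are algebraic curvature tensors with zero Ricci contraction (Weyl tensors). Complex: $V=\mathbb C^n=\mathbb R^{2n}$, $n\ge2$, $\mathfrak g=\mathfrak{su}(n)$, $N=n^2-1$, $\kappa=n+1$; $R_1$ is the curvature operator of complex projective space $\mathbb{CP}^n$ scaled so that $R_1|_{\mathfrak{su}(n)}=\operatorname{Id}$ (it acts as $n+1$ on the center $\mathfrak u(1)$ of $\mathfrak u(n)$ and vanishes on $\mathfrak u(n)^\perp$); admissible tensors are algebraic curvature tensors whose operator vanishes on $\mathfrak u(n)^\perp$ and with zero Ricci contraction (Bochner tensors); they vanish on $\mathfrak u(1)$, so are supported on $\mathfrak{su}(n)$. Quaternionic: $V=\mathbb H^n=\mathbb R^{4n}$, $n\ge2$, $\mathfrak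 g=\mathfrak{sp}(n)$, $N=n(2n+1)$, $\kappa=n+2$; $R_1$ is the curvature operator of $\mathbb{HP}^n$ scaled so that $R_1|_{\mathfrak{sp}(n)}=\operatorname{Id}$ (it acts as $n$ on $\mathfrak{sp}(1)$ and vanishes on $(\mathfrak{sp}(n)\oplus\mathfrak{sp}(1))^\perp$); admissible tensors are Ricci-flat algebraic curvature tensors whose operator vanishes on $\mathfrak{sp}(n)^\perp$ (quaternionic Weyl tensors). For $L\in\mathfrak g$ and a self-adjoint $T$ on $\mathfrak g$ (extended by zero to $\mathfrak g^\perp$), $L\cdot T=[\operatorname{ad}_L,T]$, and $\|\cdot\|$ is the Hilbert-Schmidt norm of operators. For $R=cR_1+R_0$ with $R_0$ admissible, $Q(R,R_0)=\sum_{i=1}^N\lambda_i\|\eta_i\cdot R_0\|^2$, where $\eta_1,\dots,\eta_N$ is an orthonormal eigenbasis of $R|_{\mathfrak g}=c\operatorname{Id}+R_0|_{\mathfrak g}$ with eigenvalues $\lambda_1\le\cdots\le\lambda_N$. For a self-adjoint operator with eigenvalues $\lambda_1\le\cdots\le\lambda_m$ and real $1\le k\le m$, $\Sigma_k=\lambda_1+\cdots+\lambda_{\lfloor k\rfloor}+(k-\lfloor k\rfloor)\lambda_{\lfloor k\rfloor+1}$, the last term being omitted for integer $k$. *)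

theory Defs
  imports "HOL-Analysis.Analysis"
begin

section \<open>Skew endomorphisms and curvature operators\<close>

text \<open>
  Endomorphisms of a Euclidean space \<open>V\<close> are elements of \<open>V \<Rightarrow>\<^sub>L V\<close> (in finite dimension every linear
  map is bounded), and \<open>\<Lambda>\<^sup>2V\<close> is identified with the skew-adjoint ones. Operators on \<open>\<Lambda>\<^sup>2V\<close> are
  functions on all endomorphisms; only their values on \<open>so_alg\<close> are meaningful.
\<close>

type_synonym 'v endo = "'v \<Rightarrow>\<^sub>L 'v"
type_synonym 'v curv_op = "'v endo \<Rightarrow> 'v endo"

definition so_alg :: "'v::euclidean_space endo set" where
  "so_alg = {L. \<forall>x y. blinfun_apply L x \<bullet> y = - (x \<bullet> blinfun_apply L y)}"

definition endo_trace :: "'v::euclidean_space endo \<Rightarrow> real" where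
  "endo_trace L = (\<Sum>b\<in>Basis. blinfun_apply L b \<bullet> b)"

definition so_inner :: "'v::euclidean_space endo \<Rightarrow> 'v endo \<Rightarrow> real" where
  "so_inner L K = - (1/2) * endo_trace (L o\<^sub>L K)"

definition wedge :: "'v::euclidean_space \<Rightarrow> 'v \<Rightarrow> 'v endo" where
  "wedge x y = Blinfun (\<lambda>z. (x \<bullet> z) *\<^sub>R y - (y \<bullet> z) *\<^sub>R x)"

definition bracket :: "'v::euclidean_space endo \<Rightarrow> 'v endo \<Rightarrow> 'v endo" where
  "bracket L K = (L o\<^sub>L K) - (K o\<^sub>L L)"

definition so_perp :: "'v::euclidean_space endo set \<Rightarrow> 'v endo set" where
  "so_perp W = {K \<in> so_alg. \<forall>L\<in>W. so_inner K L = 0}"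

text \<open>The (0,4)-tensor \<open>C(x,y,z,w)\<close> with curvature operator \<open>C\<close>.\<close>

definition curv_tensor :: "'v::euclidean_space curv_op \<Rightarrow> 'v \<Rightarrow> 'v \<Rightarrow> 'v \<Rightarrow> 'v \<Rightarrow> real" where
  "curv_tensor C x y z w = so_inner (C (wedge x y)) (wedge z w)"

definition alg_curv :: "'v::euclidean_space curv_op \<Rightarrow> bool" where
  "alg_curv C \<longleftrightarrow>
     (\<forall>L\<in>so_alg. C L \<in> so_alg) \<and>
     (\<forall>L\<in>so_alg. \<forall>K\<in>so_alg. C (L + K) = C L + C K) \<and>
     (\<forall>a. \<forall>L\<in>so_alg. C (a *\<^sub>R L) = a *\<^sub>R C L) \<and>
     (\<forall>L\<in>so_alg. \<forall>K\<in>so_alg. so_inner (C L) K = so_inner L (C K)) \<and>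
     (\<forall>x y z w. curv_tensor C x y z w + curv_tensor C y z x w + curv_tensor C z x y w = 0)"

definition ricci :: "'v::euclidean_space curv_op \<Rightarrow> 'v \<Rightarrow> 'v \<Rightarrow> real" where
  "ricci C x y = (\<Sum>e\<in>Basis. curv_tensor C x e y e)"

definition ricci_flat :: "'v::euclidean_space curv_op \<Rightarrow> bool" where
  "ricci_flat C \<longleftrightarrow> (\<forall>x y. ricci C x y = 0)"

definition op_nonzero :: "'v::euclidean_space curv_op \<Rightarrow> bool" where
  "op_nonzero T \<longleftrightarrow> (\<exists>L\<in>so_alg. T L \<noteq> 0)"

text \<open>
  The Hilbert-Schmidt norm of an operator on \<open>so_alg\<close>. The \<open>wedge a b\<close> for unordered pairs of
  distinct basis vectors form an orthonormal basis of \<open>so_alg\<close>; the double sum counts each twice.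
\<close>

definition hs_norm :: "'v::euclidean_space curv_op \<Rightarrow> real" where
  "hs_norm T = sqrt ((1/2) * (\<Sum>a\<in>Basis. \<Sum>b\<in>Basis. so_inner (T (wedge a b)) (T (wedge a b))))"

text \<open>\<open>L \<cdot> T = [ad L, T]\<close>\<close>

definition op_act :: "'v::euclidean_space endo \<Rightarrow> 'v curv_op \<Rightarrow> 'v curv_op" where
  "op_act L T = (\<lambda>K. bracket L (T K) - T (bracket L K))"

definition ordered_eigenbasis ::
    "'v::euclidean_space endo set \<Rightarrow> 'v curv_op \<Rightarrow> (nat \<Rightarrow> 'v endo) \<Rightarrow> (nat \<Rightarrow> real) \<Rightarrow> bool" where
  "ordered_eigenbasis W T \<eta> \<mu> \<longleftrightarrow>
     (\<forall>i\<in>{1..dim W}. \<eta> i \<in> W) \<and>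
     (\<forall>i\<in>{1..dim W}. \<forall>j\<in>{1..dim W}. so_inner (\<eta> i) (\<eta> j) = (if i = j then 1 else 0)) \<and>
     span (\<eta> ` {1..dim W}) = W \<and>
     (\<forall>i\<in>{1..dim W}. T (\<eta> i) = \<mu> i *\<^sub>R \<eta> i) \<and>
     (\<forall>i\<in>{1..dim W}. \<forall>j\<in>{1..dim W}. i \<le> j \<longrightarrow> \<mu> i \<le> \<mu> j)"

text \<open>
  On \<open>{1..dim W}\<close> the ordered eigenvalues of the restriction of \<open>T\<close> to \<open>W\<close> do not depend on the
  eigenbasis.
\<close>

definition eigenvals :: "'v::euclidean_space endo set \<Rightarrow> 'v curv_op \<Rightarrow> nat \<Rightarrow> real" where
  "eigenvals W T = (SOME \<mu>. \<exists>\<eta>. ordered_eigenbasis W T \<eta> \<mu>)"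

text \<open>For integer \<open>k\<close> the last term has coefficient 0.\<close>

definition Sigma_k :: "'v::euclidean_space endo set \<Rightarrow> 'v curv_op \<Rightarrow> real \<Rightarrow> real" where
  "Sigma_k W T k =
     (\<Sum>i = 1..nat \<lfloor>k\<rfloor>. eigenvals W T i) + (k - of_int \<lfloor>k\<rfloor>) * eigenvals W T (nat \<lfloor>k\<rfloor> + 1)"

text \<open>
  The value does not depend on the chosen eigenbasis: it is the trace of the composition of \<open>R\<close> on
  \<open>\<gg>\<close> with the operator of the quadratic form \<open>L \<mapsto> \<parallel>L \<cdot> R\<^sub>0\<parallel>\<^sup>2\<close>.
\<close>

definition Q_form :: "'v::euclidean_space endo set \<Rightarrow> 'v curv_op \<Rightarrow> 'v curv_op \<Rightarrow> real" where
  "Q_form \<gg> R R0 =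
     (let (\<eta>, \<mu>) = (SOME (\<eta>, \<mu>). ordered_eigenbasis \<gg> R \<eta> \<mu>)
      in \<Sum>i = 1..dim \<gg>. \<mu> i * (hs_norm (op_act (\<eta> i) R0))\<^sup>2)"

definition op_comb :: "real \<Rightarrow> 'v::euclidean_space curv_op \<Rightarrow> 'v curv_op \<Rightarrow> 'v curv_op" where
  "op_comb c R1 R0 = (\<lambda>L. c *\<^sub>R R1 L + R0 L)"


lemma wedge_apply: "blinfun_apply (wedge x y) z = (x \<bullet> z) *\<^sub>R y - (y \<bullet> z) *\<^sub>R x"
proof -
  have "bounded_linear (\<lambda>z. (x \<bullet> z) *\<^sub>R y - (y \<bullet> z) *\<^sub>R x)"
    by (intro bounded_linear_intros)
  then show ?thesis
    by (simp add: wedge_def bounded_linear_Blinfun_apply)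
qed

lemma so_algD: "L \<in> so_alg \<Longrightarrow> blinfun_apply L x \<bullet> y = - (x \<bullet> blinfun_apply L y)"
  by (simp add: so_alg_def)

lemma wedge_in_so: "wedge x y \<in> so_alg"
  by (simp add: so_alg_def wedge_apply inner_diff_left inner_diff_right inner_commute mult.commute)

lemma endo_trace_comp:
  "endo_trace (A o\<^sub>L B) =
     (\<Sum>b\<in>Basis. \<Sum>c\<in>Basis. (blinfun_apply B b \<bullet> c) * (blinfun_apply A c \<bullet> b))"
proof -
  have "blinfun_apply A (blinfun_apply B b) \<bullet> b =
      (\<Sum>c\<in>Basis. (blinfun_apply B b \<bullet> c) * (blinfun_apply A c \<bullet> b))" for b
  proof -
    have "blinfun_apply A (blinfun_apply B b) =
        blinfun_apply A (\<Sum>c\<in>Basis. (blinfun_apply B b \<bullet> c) *\<^sub>R c)"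
      by (simp add: euclidean_representation)
    also have "\<dots> = (\<Sum>c\<in>Basis. (blinfun_apply B b \<bullet> c) *\<^sub>R blinfun_apply A c)"
      by (simp add: blinfun.sum_right blinfun.scaleR_right)
    finally show ?thesis by (simp add: inner_sum_left)
  qed
  then show ?thesis by (simp add: endo_trace_def)
qed

lemma endo_trace_comp_commute: "endo_trace (A o\<^sub>L B) = endo_trace (B o\<^sub>L A)"
  unfolding endo_trace_comp by (subst sum.swap) (simp add: mult.commute)

lemma so_inner_commute: "so_inner L K = so_inner K L"
  unfolding so_inner_def by (simp add: endo_trace_comp_commute[of L K])

lemma so_inner_wedge_right:
  assumes "L \<in> so_alg"
  shows "so_inner L (wedge z w) = blinfun_apply L z \<bullet> w"
proof -
  have "endo_trace (L o\<^sub>L wedge z w) =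
      (\<Sum>b\<in>Basis. (z \<bullet> b) * (blinfun_apply L w \<bullet> b)) - (\<Sum>b\<in>Basis. (w \<bullet> b) * (blinfun_apply L z \<bullet> b))"
    by (simp add: endo_trace_def wedge_apply blinfun.diff_right blinfun.scaleR_right
        inner_diff_left sum_subtractf)
  also have "\<dots> = z \<bullet> blinfun_apply L w - w \<bullet> blinfun_apply L z"
    by (simp add: euclidean_inner[symmetric])
  also have "\<dots> = - 2 * (blinfun_apply L z \<bullet> w)"
    using so_algD[OF assms, of z w] by (simp add: inner_commute)
  finally show ?thesis by (simp add: so_inner_def)
qed

lemma so_inner_wedge_wedge:
  "so_inner (wedge x y) (wedge z w) = (x \<bullet> z) * (y \<bullet> w) - (x \<bullet> w) * (y \<bullet> z)"
  by (simp add: so_inner_wedge_right[OF wedge_in_so] wedge_apply inner_diff_left)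

lemma so_inner_self:
  assumes "L \<in> so_alg"
  shows "so_inner L L = (1/2) * (\<Sum>b\<in>Basis. (norm (blinfun_apply L b))\<^sup>2)"
  using assms by (simp add: so_inner_def endo_trace_def so_algD sum_negf power2_norm_eq_inner)

lemma so_inner_self_eq_0:
  assumes "L \<in> so_alg" "so_inner L L = 0"
  shows "L = 0"
proof -
  have "\<forall>b\<in>Basis. (norm (blinfun_apply L b))\<^sup>2 = 0"
    using assms by (simp add: so_inner_self sum_nonneg_eq_0_iff)
  then have "\<forall>b\<in>Basis. blinfun_apply L b = 0" by simp
  then show ?thesis
    by (intro blinfun_euclidean_eqI) simp
qed

lemma subspace_so_alg: "subspace so_alg"
  by (simp add: subspace_def so_alg_def blinfun.add_left blinfun.scaleR_left
      inner_add_left inner_add_right)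

lemma so_alg_sandwich:
  assumes "A \<in> so_alg" "L \<in> so_alg"
  shows "A o\<^sub>L L o\<^sub>L A \<in> so_alg"
  using so_algD[OF assms(1)] so_algD[OF assms(2)] by (simp add: so_alg_def)

lemma so_inner_diff_left: "so_inner (A - B) C = so_inner A C - so_inner B C"
  by (simp add: so_inner_def endo_trace_def blinfun.diff_left inner_diff_left sum_subtractf
      algebra_simps)

lemma so_inner_scaleR_left: "so_inner (a *\<^sub>R A) C = a * so_inner A C"
  by (simp add: so_inner_def endo_trace_def blinfun.scaleR_left sum_distrib_left[symmetric])

lemma so_inner_minus_right: "so_inner A (- C) = - so_inner A C"
  by (simp add: so_inner_def endo_trace_def blinfun.minus_left blinfun.minus_right sum_negf)

lemma so_inner_sandwich: "so_inner (A o\<^sub>L K o\<^sub>L A) P = so_inner K (A o\<^sub>L P o\<^sub>L A)"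
proof -
  have "endo_trace ((A o\<^sub>L K o\<^sub>L A) o\<^sub>L P) = endo_trace (A o\<^sub>L (K o\<^sub>L A o\<^sub>L P))"
    by (simp add: endo_trace_def)
  also have "\<dots> = endo_trace ((K o\<^sub>L A o\<^sub>L P) o\<^sub>L A)"
    by (rule endo_trace_comp_commute)
  also have "\<dots> = endo_trace (K o\<^sub>L (A o\<^sub>L P o\<^sub>L A))"
    by (simp add: endo_trace_def)
  finally show ?thesis by (simp add: so_inner_def)
qed


section \<open>The real setting\<close>

definition weyl_tensor :: "'v::euclidean_space curv_op \<Rightarrow> bool" where
  "weyl_tensor C \<longleftrightarrow> alg_curv C \<and> ricci_flat C"

definition R1_real :: "'v::euclidean_space curv_op" where
  "R1_real L = L"


section \<open>The complex setting\<close>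

definition cstruct :: "(complex ^ 'n::finite) endo" where
  "cstruct = Blinfun (\<lambda>x. \<i> *s x)"

definition u_alg :: "(complex ^ 'n::finite) endo set" where
  "u_alg = {L \<in> so_alg. \<forall>c x. blinfun_apply L (c *s x) = c *s blinfun_apply L x}"

definition su_alg :: "(complex ^ 'n::finite) endo set" where
  "su_alg = {L \<in> u_alg. (\<Sum>i\<in>UNIV. blinfun_apply L (axis i 1) $ i) = 0}"

definition bochner_tensor :: "(complex ^ 'n::finite) curv_op \<Rightarrow> bool" where
  "bochner_tensor C \<longleftrightarrow> alg_curv C \<and> (\<forall>K\<in>so_perp u_alg. C K = 0) \<and> ricci_flat C"

text \<open>
  The Fubini-Study curvature operator
  \<open>x \<and> y \<mapsto> 1/2 (x \<and> y + Jx \<and> Jy) + \<langle>Jx, y\<rangle> J\<close>, extended linearly to \<open>\<Lambda>\<^sup>2V\<close>. The lemmas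
  \<open>R1_complex_su\<close>, \<open>R1_complex_center\<close>, \<open>R1_complex_perp\<close> below confirm the normalization.
\<close>

definition R1_complex :: "(complex ^ 'n::finite) curv_op" where
  "R1_complex L = (1/2) *\<^sub>R (L - (cstruct o\<^sub>L L o\<^sub>L cstruct)) + so_inner L cstruct *\<^sub>R cstruct"

lemma cstruct_apply: "blinfun_apply cstruct x = \<i> *s x"
proof -
  have "linear (\<lambda>x :: complex ^ 'a. \<i> *s x)"
    by (auto intro!: linearI simp: vec_eq_iff algebra_simps)
  then show ?thesis
    by (simp add: cstruct_def bounded_linear_Blinfun_apply linear_conv_bounded_linear)
qed

lemma cstruct_twice: "\<i> *s (\<i> *s x) = - x" for x :: "complex ^ 'n::finite"
  by (simp add: vec_eq_iff)

lemma cstruct_in_so: "cstruct \<in> so_alg"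
  by (simp add: so_alg_def cstruct_apply inner_vec_def inner_complex_def sum_negf[symmetric])

lemma cstruct_in_u: "cstruct \<in> u_alg"
  by (simp add: u_alg_def cstruct_in_so) (simp add: cstruct_apply vec_eq_iff)

lemma u_alg_commute:
  "L \<in> u_alg \<Longrightarrow> blinfun_apply L (\<i> *s x) = \<i> *s blinfun_apply L x"
  by (simp add: u_alg_def)

lemma u_algI:
  assumes "L \<in> so_alg" "\<And>x. blinfun_apply L (\<i> *s x) = \<i> *s blinfun_apply L x"
  shows "L \<in> u_alg"
proof -
  have "blinfun_apply L (c *s x) = c *s blinfun_apply L x" for c x
  proof -
    have eq: "c *s y = Re c *\<^sub>R y + Im c *\<^sub>R (\<i> *s y)" for y :: "complex ^ 'a"
      by (simp add: vec_eq_iff complex_eq_iff)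
    show ?thesis
      by (simp only: eq blinfun.add_right blinfun.scaleR_right assms(2))
  qed
  with assms(1) show ?thesis by (simp add: u_alg_def)
qed

lemma so_inner_cstruct:
  assumes "L \<in> u_alg"
  shows "so_inner L cstruct = Im (\<Sum>i\<in>UNIV. blinfun_apply L (axis i 1) $ i)"
proof -
  have ax: "axis i \<i> = \<i> *s axis i 1" for i :: 'a
    by (simp add: vec_eq_iff axis_def)
  have "endo_trace (L o\<^sub>L cstruct) =
      (\<Sum>i\<in>UNIV. \<Sum>u\<in>{1, \<i>}. (\<i> *s blinfun_apply L (axis i u)) \<bullet> axis i u)"
    unfolding endo_trace_def Basis_vec_def
    by (subst sum.UNION_disjoint)
      (auto simp: Basis_complex_def axis_eq_axis cstruct_apply u_alg_commute[OF assms] sum.reindex add.commute)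
  also have "\<dots> = - 2 * (\<Sum>i\<in>UNIV. Im (blinfun_apply L (axis i 1) $ i))"
    by (simp add: ax u_alg_commute[OF assms] sum_distrib_left sum_negf[symmetric])
       (simp add: ax[symmetric] inner_axis inner_complex_def)
  finally show ?thesis by (simp add: so_inner_def)
qed

lemma so_inner_cstruct_self: "so_inner (cstruct :: (complex ^ 'n::finite) endo) cstruct = real CARD('n)"
  by (simp add: so_inner_cstruct[OF cstruct_in_u]) (simp add: cstruct_apply)

lemma R1_complex_su:
  assumes "L \<in> su_alg"
  shows "R1_complex L = L"
proof -
  have u: "L \<in> u_alg" and "so_inner L cstruct = 0"
    using assms so_inner_cstruct[of L] by (auto simp: su_alg_def)
  moreover have "cstruct o\<^sub>L L o\<^sub>L cstruct = - L"
    by (rule blinfun_eqI) (simp add: cstruct_apply u_alg_commute[OF u] cstruct_twice blinfun.minus_left)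
  ultimately show ?thesis by (simp add: R1_complex_def scaleR_2[symmetric])
qed

lemma R1_complex_center:
  "R1_complex (cstruct :: (complex ^ 'n::finite) endo) = (real CARD('n) + 1) *\<^sub>R cstruct"
proof -
  have "cstruct o\<^sub>L cstruct o\<^sub>L cstruct = - (cstruct :: (complex ^ 'n::finite) endo)"
    by (rule blinfun_eqI) (simp add: cstruct_apply cstruct_twice blinfun.minus_left)
  then show ?thesis
    by (simp add: R1_complex_def scaleR_2[symmetric] so_inner_cstruct_self scaleR_add_left)
qed

lemma sandwich_u:
  assumes "L \<in> u_alg"
  shows "cstruct o\<^sub>L L o\<^sub>L cstruct = - L"
  by (rule blinfun_eqI)
    (simp add: cstruct_apply u_alg_commute[OF assms] cstruct_twice blinfun.minus_left)

lemma u_proj_in_u: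
  assumes K: "K \<in> so_alg"
  shows "(1/2) *\<^sub>R (K - (cstruct o\<^sub>L K o\<^sub>L cstruct)) \<in> u_alg"
proof (rule u_algI)
  show "(1/2) *\<^sub>R (K - (cstruct o\<^sub>L K o\<^sub>L cstruct)) \<in> so_alg"
    by (intro subspace_scale[OF subspace_so_alg] subspace_diff[OF subspace_so_alg]
        so_alg_sandwich K cstruct_in_so)
next
  fix x
  show "blinfun_apply ((1/2) *\<^sub>R (K - (cstruct o\<^sub>L K o\<^sub>L cstruct))) (\<i> *s x) =
      \<i> *s blinfun_apply ((1/2) *\<^sub>R (K - (cstruct o\<^sub>L K o\<^sub>L cstruct))) x"
    using cstruct_twice[of "blinfun_apply K (\<i> *s x)"] cstruct_twice[of x]
    by (simp add: blinfun.diff_left blinfun.scaleR_left cstruct_apply blinfun.minus_right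
        vec_eq_iff algebra_simps)
qed

lemma u_proj_inner:
  assumes "L \<in> u_alg"
  shows "so_inner ((1/2) *\<^sub>R (K - (cstruct o\<^sub>L K o\<^sub>L cstruct))) L = so_inner K L"
  by (simp add: so_inner_scaleR_left so_inner_diff_left so_inner_sandwich sandwich_u[OF assms]
      so_inner_minus_right)

lemma R1_complex_perp:
  assumes "K \<in> so_perp u_alg"
  shows "R1_complex K = 0"
proof -
  define P where "P = (1/2) *\<^sub>R (K - (cstruct o\<^sub>L K o\<^sub>L cstruct))"
  have K: "K \<in> so_alg" and orth: "\<And>L. L \<in> u_alg \<Longrightarrow> so_inner K L = 0"
    using assms by (auto simp: so_perp_def)
  have Pu: "P \<in> u_alg" unfolding P_def by (rule u_proj_in_u[OF K])
  have "so_inner P P = 0"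
    using u_proj_inner[OF Pu, of K] orth[OF Pu] by (simp flip: P_def)
  then have "P = 0"
    using Pu by (auto simp: u_alg_def intro: so_inner_self_eq_0)
  moreover have "so_inner K cstruct = 0" by (rule orth[OF cstruct_in_u])
  ultimately show ?thesis by (simp add: R1_complex_def P_def)
qed

text \<open>
  Bochner tensors vanish on the center, so they are supported on \<open>su_alg\<close>; hence \<open>op_act\<close> and
  \<open>hs_norm\<close>, which work on all of \<open>so_alg\<close>, need no explicit extension by zero.
\<close>

lemma bochner_image_u:
  assumes C: "bochner_tensor C" and L: "L \<in> so_alg"
  shows "C L \<in> u_alg"
proof -
  have sa: "so_inner (C A) B = so_inner A (C B)" if "A \<in> so_alg" "B \<in> so_alg" for A B
    using C that by (simp add: bochner_tensor_def alg_curv_def)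
  have CL: "C L \<in> so_alg"
    using C L by (simp add: bochner_tensor_def alg_curv_def)
  define P where "P = (1/2) *\<^sub>R (C L - (cstruct o\<^sub>L C L o\<^sub>L cstruct))"
  have Pu: "P \<in> u_alg" unfolding P_def by (rule u_proj_in_u[OF CL])
  have D: "C L - P \<in> so_alg"
    using Pu by (intro subspace_diff[OF subspace_so_alg] CL) (simp add: u_alg_def)
  have "C L - P \<in> so_perp u_alg"
    using D u_proj_inner[of _ "C L"] by (simp add: so_perp_def so_inner_diff_left flip: P_def)
  then have PD: "so_inner (C L - P) P = 0" and "C (C L - P) = 0"
    using C Pu by (auto simp: bochner_tensor_def so_perp_def)
  moreover have "so_inner 0 L = 0"
    by (simp add: so_inner_def endo_trace_def)
  ultimately have "so_inner (C L - P) (C L) = 0"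
    using sa[OF D L] by simp
  then have "so_inner (C L - P) (C L - P) = 0"
    using PD by (metis so_inner_commute so_inner_diff_left diff_self)
  then have "C L = P"
    using so_inner_self_eq_0[OF D] by simp
  then show ?thesis using Pu by simp
qed

lemma bochner_center:
  assumes C: "bochner_tensor C"
  shows "C cstruct = 0"
proof -
  let ?J = "blinfun_apply cstruct"
  have u: "C (wedge x y) \<in> u_alg" for x y
    by (rule bochner_image_u[OF C wedge_in_so])
  have so: "C (wedge x y) \<in> so_alg" for x y
    using u[of x y] by (simp add: u_alg_def)
  have tensor: "curv_tensor C x y z w = blinfun_apply (C (wedge x y)) z \<bullet> w" for x y z w
    by (simp add: curv_tensor_def so_inner_wedge_right[OF so])
  have J_right: "curv_tensor C x y z (?J w) = - curv_tensor C x y (?J z) w" for x y z w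
    using so_algD[OF cstruct_in_so, of "blinfun_apply (C (wedge x y)) z" w]
    by (simp add: tensor cstruct_apply u_alg_commute[OF u])
  have swap: "curv_tensor C y x z w = - curv_tensor C x y z w" for x y z w
  proof -
    have "wedge y x = (- 1) *\<^sub>R wedge x y"
      by (rule blinfun_eqI) (simp add: wedge_apply blinfun.minus_left)
    moreover have "C ((- 1) *\<^sub>R wedge x y) = (- 1) *\<^sub>R C (wedge x y)"
      using C wedge_in_so[of x y] unfolding bochner_tensor_def alg_curv_def by blast
    ultimately have "C (wedge y x) = (- 1) *\<^sub>R C (wedge x y)" by (rule subst[OF sym])
    then show ?thesis by (simp add: tensor blinfun.minus_left)
  qed
  have ric: "(\<Sum>e\<in>Basis. curv_tensor C x e y e) = 0" for x y
    using C by (simp add: bochner_tensor_def ricci_flat_def ricci_def)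
  have bianchi: "curv_tensor C x y z w = - curv_tensor C y z x w - curv_tensor C z x y w" for x y z w
  proof -
    have "curv_tensor C x y z w + curv_tensor C y z x w + curv_tensor C z x y w = 0"
      using C unfolding bochner_tensor_def alg_curv_def by blast
    then show ?thesis by linarith
  qed
  have "(\<Sum>e\<in>Basis. curv_tensor C x y e (?J e)) =
      (\<Sum>e\<in>Basis. curv_tensor C y e (?J x) e - curv_tensor C x e (?J y) e)" for x y
  proof (rule sum.cong[OF refl])
    fix e :: "complex ^ 'a"
    show "curv_tensor C x y e (?J e) = curv_tensor C y e (?J x) e - curv_tensor C x e (?J y) e"
      using bianchi[of x y e "?J e"] J_right[of y e x e] J_right[of e x y e] swap[of e x "?J y" e]
      by linarith
  qed
  then have *: "(\<Sum>e\<in>Basis. curv_tensor C x y e (?J e)) = 0" for x y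
    by (simp add: sum_subtractf ric)
  have "so_inner (C (wedge x y)) cstruct = 0" for x y
  proof -
    have "blinfun_apply (C (wedge x y)) (?J b) \<bullet> b = - curv_tensor C x y b (?J b)" for b
      using so_algD[OF so, of x y "?J b" b] by (simp add: tensor inner_commute)
    then have "endo_trace (C (wedge x y) o\<^sub>L cstruct) = - (\<Sum>b\<in>Basis. curv_tensor C x y b (?J b))"
      by (simp add: endo_trace_def sum_negf)
    then show ?thesis by (simp add: so_inner_def *)
  qed
  moreover have "so_inner (C (wedge x y)) cstruct = so_inner (wedge x y) (C cstruct)" for x y
    using C wedge_in_so[of x y] cstruct_in_so unfolding bochner_tensor_def alg_curv_def by blast
  moreover have "C cstruct \<in> so_alg"
    using bochner_image_u[OF C cstruct_in_so] by (simp add: u_alg_def)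
  ultimately have "blinfun_apply (C cstruct) x \<bullet> y = 0" for x y
    using so_inner_wedge_right[of "C cstruct" x y] so_inner_commute[of "C cstruct" "wedge x y"]
    by simp
  then have "blinfun_apply (C cstruct) x = 0" for x
    using inner_eq_zero_iff by blast
  then show ?thesis
    by (intro blinfun_eqI) simp
qed


section \<open>The quaternionic setting\<close>

text \<open>
  The quaternion \<open>a + b j\<close> with complex \<open>a\<close>, \<open>b\<close> is the pair \<open>(a, b)\<close>, so \<open>j a = cnj a j\<close>, and
  \<open>\<bbbH>\<^sup>n\<close> is a right module over the quaternions.
\<close>

type_synonym quat = "complex \<times> complex"

definition qmult :: "quat \<Rightarrow> quat \<Rightarrow> quat" where
  "qmult p q = (fst p * fst q - snd p * cnj (snd q), fst p * snd q + snd p * cnj (fst q))"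

definition qscale :: "quat \<Rightarrow> (quat ^ 'n::finite) endo" where
  "qscale q = Blinfun (\<lambda>x. \<chi> i. qmult (x $ i) q)"

definition sp_alg :: "(quat ^ 'n::finite) endo set" where
  "sp_alg = {L \<in> so_alg. \<forall>q x. blinfun_apply L (blinfun_apply (qscale q) x) =
                                 blinfun_apply (qscale q) (blinfun_apply L x)}"

text \<open>Scalar multiplications by imaginary quaternions.\<close>

definition sp1_alg :: "(quat ^ 'n::finite) endo set" where
  "sp1_alg = qscale ` {q. Re (fst q) = 0}"

definition sp_sp1_alg :: "(quat ^ 'n::finite) endo set" where
  "sp_sp1_alg = {A + B | A B. A \<in> sp_alg \<and> B \<in> sp1_alg}"

definition qweyl_tensor :: "(quat ^ 'n::finite) curv_op \<Rightarrow> bool" where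
  "qweyl_tensor C \<longleftrightarrow> alg_curv C \<and> ricci_flat C \<and> (\<forall>K\<in>so_perp sp_alg. C K = 0)"

definition Iq :: "(quat ^ 'n::finite) endo" where "Iq = qscale (\<i>, 0)"
definition Jq :: "(quat ^ 'n::finite) endo" where "Jq = qscale (0, 1)"
definition Kq :: "(quat ^ 'n::finite) endo" where "Kq = qscale (0, \<i>)"

text \<open>
  The curvature operator of quaternionic projective space,
  \<open>x \<and> y \<mapsto> 1/4 (x \<and> y + \<Sum>\<^sub>A Ax \<and> Ay) + 1/2 \<Sum>\<^sub>A \<langle>Ax, y\<rangle> A\<close> with \<open>A\<close> ranging over \<open>Iq\<close>, \<open>Jq\<close>, \<open>Kq\<close>.
  The lemmas \<open>R1_quat_sp\<close>, \<open>R1_quat_sp1\<close>, \<open>R1_quat_perp\<close> below confirm the normalization.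
\<close>

definition R1_quat :: "(quat ^ 'n::finite) curv_op" where
  "R1_quat L =
     (1/4) *\<^sub>R (L - (Iq o\<^sub>L L o\<^sub>L Iq) - (Jq o\<^sub>L L o\<^sub>L Jq) - (Kq o\<^sub>L L o\<^sub>L Kq)) +
     (1/2) *\<^sub>R (so_inner L Iq *\<^sub>R Iq + so_inner L Jq *\<^sub>R Jq + so_inner L Kq *\<^sub>R Kq)"

lemma qscale_apply: "blinfun_apply (qscale q) x = (\<chi> i. qmult (x $ i) q)"
proof -
  have "linear (\<lambda>x :: quat ^ 'a. \<chi> i. qmult (x $ i) q)"
    by (auto intro!: linearI simp: vec_eq_iff qmult_def algebra_simps scaleR_conv_of_real)
  then show ?thesis
    by (simp add: qscale_def bounded_linear_Blinfun_apply linear_conv_bounded_linear)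
qed

lemma qmult_assoc: "qmult (qmult p q) r = qmult p (qmult q r)"
  by (simp add: qmult_def algebra_simps)

lemma qscale_qscale:
  "blinfun_apply (qscale q) (blinfun_apply (qscale p) x) = blinfun_apply (qscale (qmult p q)) x"
  by (simp add: qscale_apply vec_eq_iff qmult_assoc)

lemma qscale_eq: "qscale q = Re (fst q) *\<^sub>R id_blinfun + Im (fst q) *\<^sub>R Iq + Re (snd q) *\<^sub>R Jq + Im (snd q) *\<^sub>R Kq"
  by (rule blinfun_eqI)
    (simp add: Iq_def Jq_def Kq_def blinfun.add_left blinfun.scaleR_left qscale_apply vec_eq_iff
      prod_eq_iff qmult_def complex_eq_iff algebra_simps)

lemma IJKq_apply:
  "blinfun_apply Iq (blinfun_apply Iq x) = - x"
  "blinfun_apply Jq (blinfun_apply Jq x) = - x"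
  "blinfun_apply Kq (blinfun_apply Kq x) = - x"
  "blinfun_apply Iq (blinfun_apply Jq x) = - blinfun_apply Kq x"
  "blinfun_apply Jq (blinfun_apply Iq x) = blinfun_apply Kq x"
  "blinfun_apply Jq (blinfun_apply Kq x) = - blinfun_apply Iq x"
  "blinfun_apply Kq (blinfun_apply Jq x) = blinfun_apply Iq x"
  "blinfun_apply Kq (blinfun_apply Iq x) = - blinfun_apply Jq x"
  "blinfun_apply Iq (blinfun_apply Kq x) = blinfun_apply Jq x"
  by (simp_all add: Iq_def Jq_def Kq_def qscale_qscale)
    (simp_all add: qscale_apply vec_eq_iff prod_eq_iff qmult_def)

lemma IJKq_in_so: "Iq \<in> so_alg" "Jq \<in> so_alg" "Kq \<in> so_alg"
  by (simp_all add: Iq_def Jq_def Kq_def so_alg_def qscale_apply qmult_def inner_vec_def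
      inner_prod_def inner_complex_def sum_negf[symmetric] algebra_simps)

lemma sp1_alg_eq: "sp1_alg = {a *\<^sub>R Iq + b *\<^sub>R Jq + c *\<^sub>R Kq | a b c. True}"
proof -
  have "a *\<^sub>R Iq + b *\<^sub>R Jq + c *\<^sub>R Kq \<in> sp1_alg" for a b c
    unfolding sp1_alg_def by (rule image_eqI[of _ _ "(Complex 0 a, Complex b c)"]) (simp_all add: qscale_eq)
  then show ?thesis by (force simp: sp1_alg_def qscale_eq)
qed

lemma sp_alg_commute:
  assumes "L \<in> sp_alg"
  shows "blinfun_apply L (blinfun_apply Iq x) = blinfun_apply Iq (blinfun_apply L x)"
    and "blinfun_apply L (blinfun_apply Jq x) = blinfun_apply Jq (blinfun_apply L x)"
    and "blinfun_apply L (blinfun_apply Kq x) = blinfun_apply Kq (blinfun_apply L x)"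
  using assms by (simp_all add: sp_alg_def Iq_def Jq_def Kq_def)

lemma sp_algI:
  assumes "L \<in> so_alg"
    and "\<And>x. blinfun_apply L (blinfun_apply Iq x) = blinfun_apply Iq (blinfun_apply L x)"
    and "\<And>x. blinfun_apply L (blinfun_apply Jq x) = blinfun_apply Jq (blinfun_apply L x)"
    and "\<And>x. blinfun_apply L (blinfun_apply Kq x) = blinfun_apply Kq (blinfun_apply L x)"
  shows "L \<in> sp_alg"
  using assms by (simp add: sp_alg_def qscale_eq blinfun.add_left blinfun.add_right
      blinfun.scaleR_left blinfun.scaleR_right)

lemma sandwich_sp:
  assumes "L \<in> sp_alg"
  shows "Iq o\<^sub>L L o\<^sub>L Iq = - L" "Jq o\<^sub>L L o\<^sub>L Jq = - L" "Kq o\<^sub>L L o\<^sub>L Kq = - L"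
  by (rule blinfun_eqI, simp add: sp_alg_commute[OF assms] IJKq_apply blinfun.minus_left)+

lemma sandwich_sp1:
  "Iq o\<^sub>L Iq o\<^sub>L Iq = - Iq" "Jq o\<^sub>L Iq o\<^sub>L Jq = Iq" "Kq o\<^sub>L Iq o\<^sub>L Kq = Iq"
  "Iq o\<^sub>L Jq o\<^sub>L Iq = Jq" "Jq o\<^sub>L Jq o\<^sub>L Jq = - Jq" "Kq o\<^sub>L Jq o\<^sub>L Kq = Jq"
  "Iq o\<^sub>L Kq o\<^sub>L Iq = Kq" "Jq o\<^sub>L Kq o\<^sub>L Jq = Kq" "Kq o\<^sub>L Kq o\<^sub>L Kq = - Kq"
  by (rule blinfun_eqI, simp add: IJKq_apply blinfun.minus_left blinfun.minus_right)+

lemma so_inner_sp_sp1: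
  assumes "L \<in> sp_alg"
  shows "so_inner L Iq = 0" "so_inner L Jq = 0" "so_inner L Kq = 0"
  using so_inner_sandwich[of Jq L Iq] so_inner_sandwich[of Iq L Jq] so_inner_sandwich[of Iq L Kq]
  by (simp_all add: sandwich_sp[OF assms] sandwich_sp1 so_inner_def endo_trace_def
      blinfun.minus_left sum_negf)

lemma so_inner_IJKq:
  "so_inner (Iq :: (quat ^ 'n::finite) endo) Iq = 2 * real CARD('n)"
  "so_inner (Jq :: (quat ^ 'n::finite) endo) Jq = 2 * real CARD('n)"
  "so_inner (Kq :: (quat ^ 'n::finite) endo) Kq = 2 * real CARD('n)"
  "so_inner (Iq :: (quat ^ 'n::finite) endo) Jq = 0"
  "so_inner (Iq :: (quat ^ 'n::finite) endo) Kq = 0"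
  "so_inner (Jq :: (quat ^ 'n::finite) endo) Kq = 0"
proof -
  have skew: "blinfun_apply A b \<bullet> b = 0" if "A \<in> so_alg" for A :: "(quat ^ 'n) endo" and b
    using so_algD[OF that, of b b] by (simp add: inner_commute)
  show "so_inner (Iq :: (quat ^ 'n::finite) endo) Iq = 2 * real CARD('n)"
    "so_inner (Jq :: (quat ^ 'n::finite) endo) Jq = 2 * real CARD('n)"
    "so_inner (Kq :: (quat ^ 'n::finite) endo) Kq = 2 * real CARD('n)"
    by (simp_all add: so_inner_def endo_trace_def IJKq_apply sum_negf)
  show "so_inner (Iq :: (quat ^ 'n::finite) endo) Jq = 0"
    "so_inner (Iq :: (quat ^ 'n::finite) endo) Kq = 0"
    "so_inner (Jq :: (quat ^ 'n::finite) endo) Kq = 0"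
    by (simp_all add: so_inner_def endo_trace_def IJKq_apply skew IJKq_in_so)
qed

lemma R1_quat_sp:
  assumes "L \<in> sp_alg"
  shows "R1_quat L = L"
proof -
  have "L + L + L + L = 4 *\<^sub>R L"
    by (simp add: scaleR_left_distrib[of 2 2, simplified] scaleR_2)
  then show ?thesis
    by (simp add: R1_quat_def so_inner_sp_sp1[OF assms] sandwich_sp[OF assms])
qed

lemma R1_quat_sp1:
  assumes "L \<in> sp1_alg"
  shows "R1_quat (L :: (quat ^ 'n::finite) endo) = real CARD('n) *\<^sub>R L"
proof -
  have lin: "so_inner (A + B) C = so_inner A C + so_inner B C" for A B C :: "(quat ^ 'n) endo"
    by (simp add: so_inner_def endo_trace_def blinfun.add_left inner_add_left sum.distrib
        algebra_simps)
  obtain a b c where L: "L = a *\<^sub>R Iq + b *\<^sub>R Jq + c *\<^sub>R Kq"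
    using assms by (auto simp: sp1_alg_eq)
  have sand: "A o\<^sub>L L o\<^sub>L A = a *\<^sub>R (A o\<^sub>L Iq o\<^sub>L A) + b *\<^sub>R (A o\<^sub>L Jq o\<^sub>L A) + c *\<^sub>R (A o\<^sub>L Kq o\<^sub>L A)"
    for A :: "(quat ^ 'n) endo"
    by (rule blinfun_eqI) (simp add: L blinfun.add_left blinfun.add_right
        blinfun.scaleR_left blinfun.scaleR_right)
  have "L - (Iq o\<^sub>L L o\<^sub>L Iq) - (Jq o\<^sub>L L o\<^sub>L Jq) - (Kq o\<^sub>L L o\<^sub>L Kq) = 0"
    unfolding sand sandwich_sp1 by (simp add: L)
  moreover have "so_inner L Iq = 2 * real CARD('n) * a" "so_inner L Jq = 2 * real CARD('n) * b"
    "so_inner L Kq = 2 * real CARD('n) * c"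
    by (simp_all add: L lin so_inner_scaleR_left so_inner_IJKq so_inner_commute[of Jq Iq]
        so_inner_commute[of Kq Iq] so_inner_commute[of Kq Jq])
  ultimately show ?thesis
    by (simp add: R1_quat_def L scaleR_add_right)
qed

lemma R1_quat_perp:
  assumes "K \<in> so_perp sp_sp1_alg"
  shows "R1_quat K = 0"
proof -
  define P where "P = (1/4) *\<^sub>R (K - (Iq o\<^sub>L K o\<^sub>L Iq) - (Jq o\<^sub>L K o\<^sub>L Jq) - (Kq o\<^sub>L K o\<^sub>L Kq))"
  have K: "K \<in> so_alg" and orth: "\<And>L. L \<in> sp_sp1_alg \<Longrightarrow> so_inner K L = 0"
    using assms by (auto simp: so_perp_def)
  have zero: "0 \<in> sp_alg" "0 \<in> sp1_alg"
    using subspace_0[OF subspace_so_alg]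
    by (simp_all add: sp_alg_def) (auto simp: sp1_alg_eq intro!: exI[of _ "0::real"])
  have sub: "sp_alg \<subseteq> sp_sp1_alg" "sp1_alg \<subseteq> sp_sp1_alg"
    using zero by (force simp: sp_sp1_alg_def)+
  have "P \<in> so_alg"
    unfolding P_def
    by (intro subspace_scale[OF subspace_so_alg] subspace_diff[OF subspace_so_alg]
        so_alg_sandwich K IJKq_in_so)
  then have Psp: "P \<in> sp_alg"
    by (rule sp_algI)
      (simp_all add: P_def blinfun.diff_left blinfun.diff_right blinfun.scaleR_left
        blinfun.scaleR_right blinfun.minus_right blinfun.minus_left IJKq_apply)
  have "so_inner P P = (1/4) * (so_inner K P - so_inner K (Iq o\<^sub>L P o\<^sub>L Iq) -
      so_inner K (Jq o\<^sub>L P o\<^sub>L Jq) - so_inner K (Kq o\<^sub>L P o\<^sub>L Kq))"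
    by (subst (1) P_def) (simp add: so_inner_scaleR_left so_inner_diff_left so_inner_sandwich)
  also have "\<dots> = 0"
    using orth Psp sub by (auto simp: sandwich_sp[OF Psp] so_inner_minus_right)
  finally have "P = 0"
    using Psp by (auto simp: sp_alg_def intro: so_inner_self_eq_0)
  moreover have "Iq \<in> sp1_alg" "Jq \<in> sp1_alg" "Kq \<in> sp1_alg"
    by (force simp: sp1_alg_def Iq_def Jq_def Kq_def)+
  then have "so_inner K Iq = 0" "so_inner K Jq = 0" "so_inner K Kq = 0"
    using orth sub by auto
  ultimately show ?thesis by (simp add: R1_quat_def P_def)
qed

end

theory Submission
  imports Defs
begin

text \<open>
  One construction serves all three settings. Choose orthonormal vectors \<open>e0, e1, e2, e3\<close>, think of
  their span as the quaternions, and let \<open>E1, E2, E3\<close> be the left multiplications by \<open>i, j, k\<close> divided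
  by \<open>sqrt 2\<close> and extended by zero. They are orthonormal, satisfy \<open>[E1, E2] = sqrt 2 E3\<close> cyclically, and
  for a suitable frame they lie in \<open>\<gg>\<close>; they span the \<open>su(2)\<close> of a long root. The tensor \<open>R\<^sub>*\<close> is the
  operator with eigenvalues \<open>-1, -1, 2\<close> on \<open>E1, E2, E3\<close> and zero on their orthogonal complement. As
  2-forms the \<open>E\<^sub>a\<close> have the same wedge square, and as endomorphisms they have the same square, so the
  Bianchi sum and the Ricci contraction of \<open>R\<^sub>*\<close> are multiples of its trace \<open>-1 - 1 + 2 = 0\<close>
  (\<open>alg_curv_Rs\<close>, \<open>ricci_flat_Rs\<close>).

  The negative part of \<open>R\<^sub>*\<close> is minus the orthogonal projection to \<open>E1, E2\<close>, which has trace 2. Hence any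
  weighted sum of eigenvalues of \<open>c R\<^sub>1 + R\<^sub>*\<close>, with weights between 0 and 1 of total \<open>k\<close>, is at least
  \<open>c k - 2\<close>; this needs only \<open>R\<^sub>1 \<ge> Id\<close>, so it covers the larger algebras \<open>u(n)\<close> and
  \<open>sp(n) + sp(1)\<close> as well (\<open>Sigma_k_pos\<close>).

  The quadratic form \<open>q(L) = \<parallel>L \<cdot> R\<^sub>*\<parallel>\<^sup>2\<close> is explicit (\<open>hs_norm_act_Rs\<close>): it is 36 at \<open>E1\<close> and \<open>E2\<close>,
  which is (a) because \<open>\<parallel>R\<^sub>*\<parallel>\<^sup>2 = 6\<close>, and it is 0 at \<open>E3\<close>. Its trace over \<open>\<gg>\<close> is \<open>24 \<kappa>\<close>, because
  \<open>- ad(E\<^sub>a)\<^sup>2\<close> has trace \<open>2 (\<kappa> - 1)\<close> on \<open>\<gg>\<close>. Since \<open>Q(R\<^sub>c, R\<^sub>*)\<close> is the trace of the composition of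
  \<open>c Id + R\<^sub>*\<close> with the operator of \<open>q\<close>, it equals \<open>24 \<kappa> c - 36 - 36 + 2 * 0\<close>, which is negative
  exactly for \<open>c < 3 / \<kappa>\<close> (\<open>Q_form_eq\<close>).

  What differs between the settings is \<open>dim \<gg>\<close> and the trace of \<open>ad(E\<^sub>a)\<^sup>2\<close> on \<open>\<gg>\<close>. Both are traces over
  all of \<open>\<Lambda>\<^sup>2V\<close> after composing with the orthogonal projection to \<open>\<gg>\<close>, and that projection is a
  combination of maps \<open>L \<mapsto> X L Y\<close> and maps of rank one, whose traces on \<open>\<Lambda>\<^sup>2V\<close> have closed forms
  (\<open>op_trace_sandwich\<close>, \<open>op_trace_rank1\<close>).
\<close>

section \<open>The inner product on skew endomorphisms\<close>

lemma linear_so_inner_left: "linear (\<lambda>L. so_inner L K)"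
  by (rule linearI) (simp_all add: so_inner_def endo_trace_def blinfun.add_left blinfun.scaleR_left
      inner_add_left sum.distrib sum_distrib_left algebra_simps)

lemma linear_so_inner_right: "linear (so_inner L)"
proof -
  have "so_inner L = (\<lambda>K. so_inner K L)" by (rule ext) (rule so_inner_commute)
  then show ?thesis by (simp add: linear_so_inner_left)
qed

lemmas so_inner_linear =
  linear_add[OF linear_so_inner_left] linear_add[OF linear_so_inner_right]
  linear_diff[OF linear_so_inner_left] linear_diff[OF linear_so_inner_right]
  linear_neg[OF linear_so_inner_left] linear_neg[OF linear_so_inner_right]
  linear_cmul[OF linear_so_inner_left] linear_cmul[OF linear_so_inner_right]
  linear_0[OF linear_so_inner_left] linear_0[OF linear_so_inner_right]

lemma so_inner_sum_left: "so_inner (sum f A) K = (\<Sum>a\<in>A. so_inner (f a) K)"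
  by (rule linear_sum[OF linear_so_inner_left])

lemma so_inner_sum_right: "so_inner K (sum f A) = (\<Sum>a\<in>A. so_inner K (f a))"
  by (rule linear_sum[OF linear_so_inner_right])

lemma so_inner_eq_sum:
  assumes "L \<in> so_alg"
  shows "so_inner L K = (1/2) * (\<Sum>b\<in>Basis. blinfun_apply L b \<bullet> blinfun_apply K b)"
proof -
  have "blinfun_apply L (blinfun_apply K b) \<bullet> b = - (blinfun_apply L b \<bullet> blinfun_apply K b)" for b
    by (metis so_algD[OF assms] inner_commute)
  then show ?thesis by (simp add: so_inner_def endo_trace_def sum_negf)
qed

lemma so_inner_self_nonneg: "L \<in> so_alg \<Longrightarrow> 0 \<le> so_inner L L"
  by (simp add: so_inner_self sum_nonneg)

text \<open>
  The factor 1/2 is there because the double sum runs over ordered pairs of basis vectors.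
\<close>

lemma parseval_wedge:
  assumes X: "X \<in> so_alg" and Y: "Y \<in> so_alg"
  shows "(1/2) * (\<Sum>a\<in>Basis. \<Sum>b\<in>Basis. so_inner (wedge a b) X * so_inner (wedge a b) Y) = so_inner X Y"
proof -
  have "(\<Sum>a\<in>Basis. \<Sum>b\<in>Basis. so_inner (wedge a b) X * so_inner (wedge a b) Y) =
      (\<Sum>a\<in>Basis. blinfun_apply X a \<bullet> blinfun_apply Y a)"
    by (simp add: so_inner_commute[of "wedge _ _"] so_inner_wedge_right X Y euclidean_inner[symmetric])
  then show ?thesis by (simp add: so_inner_eq_sum[OF X])
qed

lemma bracket_apply:
  "blinfun_apply (bracket L K) x =
     blinfun_apply L (blinfun_apply K x) - blinfun_apply K (blinfun_apply L x)"
  by (simp add: bracket_def blinfun.diff_left)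

lemma linear_bracket_right: "linear (bracket L)"
  by (rule linearI; rule blinfun_eqI) (simp_all add: bracket_apply blinfun.add_left blinfun.add_right
      blinfun.scaleR_left blinfun.scaleR_right algebra_simps)

lemma bracket_swap: "bracket L K = - bracket K L"
  by (simp add: bracket_def)

lemma bracket_in_so:
  assumes "L \<in> so_alg" "K \<in> so_alg" shows "bracket L K \<in> so_alg"
  using so_algD[OF assms(1)] so_algD[OF assms(2)]
  by (simp add: so_alg_def bracket_apply inner_diff_left inner_diff_right)

text \<open>Invariance of the inner product under the adjoint action, from the cyclicity of the trace.\<close>

lemma so_inner_bracket: "so_inner (bracket L K) M = so_inner L (bracket K M)"
proof -
  have "endo_trace (K o\<^sub>L (L o\<^sub>L M)) = endo_trace ((L o\<^sub>L M) o\<^sub>L K)"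
    by (rule endo_trace_comp_commute)
  moreover have "(L o\<^sub>L M) o\<^sub>L K = L o\<^sub>L (M o\<^sub>L K)" "K o\<^sub>L (L o\<^sub>L M) = (K o\<^sub>L L) o\<^sub>L M"
    "(L o\<^sub>L K) o\<^sub>L M = L o\<^sub>L (K o\<^sub>L M)"
    by (auto intro!: blinfun_eqI)
  moreover have "endo_trace (A - B) = endo_trace A - endo_trace B" for A B :: "'a endo"
    by (simp add: endo_trace_def blinfun.diff_left inner_diff_left sum_subtractf)
  moreover have "bracket L K o\<^sub>L M = ((L o\<^sub>L K) o\<^sub>L M) - ((K o\<^sub>L L) o\<^sub>L M)"
    "L o\<^sub>L bracket K M = (L o\<^sub>L (K o\<^sub>L M)) - (L o\<^sub>L (M o\<^sub>L K))"
    by (auto intro!: blinfun_eqI simp: bracket_apply blinfun.diff_left blinfun.diff_right)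
  ultimately show ?thesis by (simp add: so_inner_def)
qed


section \<open>Orthonormal bases of subspaces of the skew endomorphisms\<close>

text \<open>
  The inner product \<open>so_inner\<close> is not the inner product of a type class on endomorphisms, so
  orthonormal bases, their extension and the Parseval identity are developed for it here.
\<close>

definition so_orthonormal :: "'v::euclidean_space endo set \<Rightarrow> bool" where
  "so_orthonormal B \<longleftrightarrow> B \<subseteq> so_alg \<and> (\<forall>L\<in>B. \<forall>K\<in>B. so_inner L K = (if L = K then 1 else 0))"

definition so_onb :: "'v::euclidean_space endo set \<Rightarrow> 'v endo set \<Rightarrow> bool" where
  "so_onb W B \<longleftrightarrow> finite B \<and> so_orthonormal B \<and> span B = W"

lemma so_onb_subset: "so_onb W B \<Longrightarrow> W \<subseteq> so_alg"
  unfolding so_onb_def so_orthonormal_def using span_minimal[OF _ subspace_so_alg] by blast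

lemma so_orthonormal_sum:
  assumes "so_orthonormal B" "finite B" "K \<in> B"
  shows "so_inner (\<Sum>\<eta>\<in>B. f \<eta> *\<^sub>R \<eta>) K = f K"
proof -
  have "so_inner (\<Sum>\<eta>\<in>B. f \<eta> *\<^sub>R \<eta>) K = (\<Sum>\<eta>\<in>B. if \<eta> = K then f \<eta> else 0)"
    unfolding so_inner_sum_left
    by (rule sum.cong) (use assms in \<open>auto simp: so_inner_linear so_orthonormal_def\<close>)
  then show ?thesis using assms by simp
qed

lemma so_orthonormal_independent:
  assumes "so_orthonormal B" "finite B"
  shows "independent B"
proof (rule independent_if_scalars_zero[OF assms(2)])
  fix f K assume "(\<Sum>\<eta>\<in>B. f \<eta> *\<^sub>R \<eta>) = 0" "K \<in> B"
  then show "f K = 0"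
    using so_orthonormal_sum[OF assms, of K f] by (simp add: so_inner_linear)
qed

lemma so_onb_dim: "so_onb W B \<Longrightarrow> dim W = card B"
  unfolding so_onb_def using so_orthonormal_independent dim_eq_card_independent dim_span by metis

lemma so_onb_expand:
  assumes "so_onb W B" "L \<in> W"
  shows "L = (\<Sum>\<eta>\<in>B. so_inner L \<eta> *\<^sub>R \<eta>)"
proof -
  have B: "finite B" "so_orthonormal B" "L \<in> span B" using assms by (auto simp: so_onb_def)
  then obtain f where f: "L = (\<Sum>\<eta>\<in>B. f \<eta> *\<^sub>R \<eta>)" by (auto simp: span_finite)
  have "so_inner L K = f K" if "K \<in> B" for K
    unfolding f by (rule so_orthonormal_sum[OF B(2,1) that])
  then show ?thesis by (subst f) simp
qed

lemma so_onb_parseval: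
  assumes "so_onb W B" "L \<in> W"
  shows "(\<Sum>\<eta>\<in>B. so_inner L \<eta> * so_inner \<eta> K) = so_inner L K"
  using arg_cong[OF so_onb_expand[OF assms], of "\<lambda>X. so_inner X K"]
  by (simp add: so_inner_sum_left so_inner_linear)

lemma so_alg_span_wedge:
  "so_alg \<subseteq> span ((\<lambda>(a, b). wedge a b) ` (Basis \<times> (Basis :: 'v::euclidean_space set)))"
proof
  fix L :: "'v endo" assume L: "L \<in> so_alg"
  define D where "D = (1/2) *\<^sub>R (\<Sum>a\<in>Basis. \<Sum>b\<in>Basis. so_inner (wedge a b) L *\<^sub>R wedge a b)"
  have "D \<in> span ((\<lambda>(a, b). wedge a b) ` (Basis \<times> Basis))"
    unfolding D_def by (intro span_scale span_sum span_base) auto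
  moreover have "D \<in> so_alg"
    unfolding D_def by (intro subspace_scale subspace_sum subspace_so_alg wedge_in_so)
  then have so: "D - L \<in> so_alg" by (rule subspace_diff[OF subspace_so_alg _ L])
  have "so_inner D K = so_inner L K" if "K \<in> so_alg" for K
    using parseval_wedge[OF L that] by (simp add: D_def so_inner_linear so_inner_sum_left)
  then have "so_inner (D - L) (D - L) = 0"
    using so by (simp add: so_inner_linear(3))
  then have "D = L" using so_inner_self_eq_0[OF so] by simp
  ultimately show "L \<in> span ((\<lambda>(a, b). wedge a b) ` (Basis \<times> Basis))" by simp
qed

text \<open>
  The finite set of the \<open>wedge a b\<close> spans \<open>so_alg\<close> and bounds the size of an orthonormal set, so a
  largest one between \<open>S\<close> and \<open>W\<close> exists; one Gram-Schmidt step shows that it spans \<open>W\<close>.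
\<close>

lemma so_onb_extend:
  assumes W: "subspace W" "W \<subseteq> so_alg" and S: "so_orthonormal S" "finite S" "S \<subseteq> W"
  shows "\<exists>B. so_onb W B \<and> S \<subseteq> B"
proof -
  let ?w = "(\<lambda>(a, b). wedge a b) ` (Basis \<times> (Basis :: 'a set))"
  let ?P = "\<lambda>B. finite B \<and> so_orthonormal B \<and> S \<subseteq> B \<and> B \<subseteq> W"
  have "card B \<le> card ?w" if "?P B" for B
    using independent_span_bound[of ?w B] so_orthonormal_independent[of B] so_alg_span_wedge W(2) that
    by fastforce
  then obtain B where B: "?P B" and mx: "\<And>B'. ?P B' \<Longrightarrow> card B' \<le> card B"
    using ex_has_greatest_nat[of ?P S card "Suc (card ?w)"] S by (metis less_Suc_eq_le order.refl)
  have "L \<in> span B" if L: "L \<in> W" for L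
  proof (rule ccontr)
    assume nin: "L \<notin> span B"
    define D where "D = L - (\<Sum>\<eta>\<in>B. so_inner L \<eta> *\<^sub>R \<eta>)"
    have sp: "(\<Sum>\<eta>\<in>B. so_inner L \<eta> *\<^sub>R \<eta>) \<in> span B"
      by (intro span_sum span_scale span_base)
    have "D \<noteq> 0" using nin sp by (auto simp: D_def)
    have DW: "D \<in> W" unfolding D_def
      using B by (intro subspace_diff[OF W(1)] L subspace_sum[OF W(1)] subspace_scale[OF W(1)]) auto
    then have Dso: "D \<in> so_alg" using W by auto
    have orth: "so_inner D K = 0" if "K \<in> B" for K
      using so_orthonormal_sum[of B K "so_inner L"] B that by (simp add: D_def so_inner_linear)
    have pos: "so_inner D D > 0"
      using so_inner_self_eq_0[OF Dso] so_inner_self_nonneg[OF Dso] \<open>D \<noteq> 0\<close> by force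
    define U where "U = (1 / sqrt (so_inner D D)) *\<^sub>R D"
    have UU: "so_inner U U = 1"
      using pos by (simp add: U_def so_inner_linear)
    have U0: "so_inner U K = 0" "so_inner K U = 0" if "K \<in> B" for K
      using orth[OF that] by (simp_all add: U_def so_inner_linear so_inner_commute[of K])
    have UW: "U \<in> W" by (simp add: U_def subspace_scale[OF W(1)] DW)
    have "U \<notin> B" using U0 UU by force
    have "?P (insert U B)"
      using B UW W(2) UU U0 \<open>U \<notin> B\<close> by (auto simp: so_orthonormal_def)
    from mx[OF this] show False using B \<open>U \<notin> B\<close> by simp
  qed
  moreover have "span B \<subseteq> W" using span_minimal[OF _ W(1)] B by blast
  ultimately show ?thesis using B by (auto simp: so_onb_def)
qed

text \<open>
  Sorting is stable, so a list that is already ordered by eigenvalue is kept as it is. This is how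
  the first two members of the eigenbasis in \<open>Rs_eigenbasis\<close> below are prescribed.
\<close>

lemma so_onb_list_eigenbasis:
  assumes "so_onb W (set bs)" "distinct bs" "\<And>L. L \<in> set bs \<Longrightarrow> T L = f L *\<^sub>R L"
  shows "ordered_eigenbasis W T (\<lambda>i. sort_key f bs ! (i - 1)) (\<lambda>i. f (sort_key f bs ! (i - 1)))"
proof -
  let ?s = "sort_key f bs"
  have len: "dim W = length ?s" using so_onb_dim[OF assms(1)] assms(2) by (simp add: distinct_card)
  have nth: "?s ! (i - 1) \<in> set bs" if "i \<in> {1..length ?s}" for i
  proof -
    have "?s ! (i - 1) \<in> set ?s" using that by (intro nth_mem) auto
    then show ?thesis by simp
  qed
  have eq: "?s ! (i - 1) = ?s ! (j - 1) \<longleftrightarrow> i = j" if "i \<in> {1..length ?s}" "j \<in> {1..length ?s}" for i j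
  proof -
    have "i - 1 < length ?s" "j - 1 < length ?s" "distinct ?s" using that assms(2) by auto
    then have "?s ! (i - 1) = ?s ! (j - 1) \<longleftrightarrow> i - 1 = j - 1" by (metis nth_eq_iff_index_eq)
    then show ?thesis using that by auto
  qed
  have img: "(\<lambda>i. ?s ! (i - 1)) ` {1..length ?s} = set bs"
  proof
    show "set bs \<subseteq> (\<lambda>i. ?s ! (i - 1)) ` {1..length ?s}"
    proof
      fix x assume "x \<in> set bs"
      then have "x \<in> set ?s" by simp
      then obtain i where "i < length ?s" "x = ?s ! i" by (metis in_set_conv_nth)
      then show "x \<in> (\<lambda>i. ?s ! (i - 1)) ` {1..length ?s}"
        by (intro image_eqI[of _ _ "Suc i"]) auto
    qed
  qed (use nth in blast)
  have mono: "f (?s ! (i - 1)) \<le> f (?s ! (j - 1))"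
    if "i \<in> {1..length ?s}" "j \<in> {1..length ?s}" "i \<le> j" for i j
    using sorted_nth_mono[OF sorted_sort_key[of f bs], of "i - 1" "j - 1"] that by auto
  have B: "so_orthonormal (set bs)" "span (set bs) = W" using assms(1) by (auto simp: so_onb_def)
  then have sub: "set bs \<subseteq> W" using span_superset by blast
  show ?thesis
    unfolding ordered_eigenbasis_def len
  proof (intro conjI ballI impI)
    fix i j assume i: "i \<in> {1..length ?s}" and j: "j \<in> {1..length ?s}"
    show "so_inner (?s ! (i - 1)) (?s ! (j - 1)) = (if i = j then 1 else 0)"
      using nth[OF i] nth[OF j] eq[OF i j] B(1) by (simp add: so_orthonormal_def del: One_nat_def)
    show "f (?s ! (i - 1)) \<le> f (?s ! (j - 1))" if "i \<le> j" using mono i j that by blast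
  qed (use nth sub img B(2) assms(3) in auto)
qed

lemma ordered_eigenbasis_exists:
  assumes "so_onb W B" "\<And>L. L \<in> B \<Longrightarrow> T L = f L *\<^sub>R L"
  shows "\<exists>\<eta> \<mu>. ordered_eigenbasis W T \<eta> \<mu>"
proof -
  obtain bs where "set bs = B" "distinct bs"
    using finite_distinct_list assms(1) unfolding so_onb_def by blast
  then show ?thesis using so_onb_list_eigenbasis[of W bs T f] assms by blast
qed

lemma ordered_eigenbasis_onb:
  assumes "ordered_eigenbasis W T \<eta> \<mu>" "W \<subseteq> so_alg"
  shows "so_onb W (\<eta> ` {1..dim W})" "inj_on \<eta> {1..dim W}"
proof -
  have on: "so_inner (\<eta> i) (\<eta> j) = (if i = j then 1 else 0)" if "i \<in> {1..dim W}" "j \<in> {1..dim W}" for i j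
    using assms(1) that unfolding ordered_eigenbasis_def by blast
  show inj: "inj_on \<eta> {1..dim W}"
    using on by (intro inj_onI) (metis zero_neq_one)
  show "so_onb W (\<eta> ` {1..dim W})"
    unfolding so_onb_def so_orthonormal_def
    using assms on by (auto simp: ordered_eigenbasis_def inj_on_eq_iff[OF inj])
qed

lemma so_onb_union:
  assumes B: "so_onb W B" and Z: "so_orthonormal Z" "finite Z"
    and orth: "\<And>L K. L \<in> W \<Longrightarrow> K \<in> Z \<Longrightarrow> so_inner L K = 0"
  shows "so_onb (span (W \<union> Z)) (B \<union> Z)" "B \<inter> Z = {}"
proof -
  have BW: "B \<subseteq> W" and W: "span B = W" using B span_superset by (auto simp: so_onb_def)
  have orth': "so_inner K L = 0" if "L \<in> W" "K \<in> Z" for L K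
    using orth[OF that] by (simp add: so_inner_commute[of K])
  show "B \<inter> Z = {}"
  proof (rule ccontr)
    assume "B \<inter> Z \<noteq> {}"
    then obtain L where "L \<in> B" "L \<in> Z" by blast
    then have "so_inner L L = 0" "so_inner L L = 1"
      using orth[of L L] BW Z(1) by (auto simp: so_orthonormal_def)
    then show False by simp
  qed
  have "span (W \<union> Z) = span (B \<union> Z)"
    unfolding W[symmetric] by (simp add: span_Un span_span)
  moreover have "so_orthonormal (B \<union> Z)"
    unfolding so_orthonormal_def
  proof (intro conjI ballI)
    show "B \<union> Z \<subseteq> so_alg" using B Z(1) by (auto simp: so_onb_def so_orthonormal_def)
    fix L K assume "L \<in> B \<union> Z" "K \<in> B \<union> Z"
    then consider "L \<in> B" "K \<in> B" | "L \<in> Z" "K \<in> Z" | "L \<in> B" "K \<in> Z" | "L \<in> Z" "K \<in> B" by blast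
    then show "so_inner L K = (if L = K then 1 else 0)"
    proof cases
      case 1 then show ?thesis using B by (simp add: so_onb_def so_orthonormal_def)
    next
      case 2 then show ?thesis using Z(1) by (simp add: so_orthonormal_def)
    next
      case 3 then show ?thesis using orth[of L K] BW \<open>B \<inter> Z = {}\<close> by auto
    next
      case 4 then show ?thesis using orth'[of K L] BW \<open>B \<inter> Z = {}\<close> by auto
    qed
  qed
  ultimately show "so_onb (span (W \<union> Z)) (B \<union> Z)"
    using B Z(2) by (simp add: so_onb_def)
qed

section \<open>Traces of operators\<close>

text \<open>
  The trace on \<open>\<Lambda>\<^sup>2V\<close>; as in \<open>parseval_wedge\<close>, each basis bivector is counted twice.
\<close>

definition op_trace :: "'v::euclidean_space curv_op \<Rightarrow> real" where
  "op_trace T = (1/2) * (\<Sum>a\<in>Basis. \<Sum>b\<in>Basis. so_inner (T (wedge a b)) (wedge a b))"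

lemma op_trace_linear:
  "op_trace (\<lambda>L. S L + T L) = op_trace S + op_trace T"
  "op_trace (\<lambda>L. S L - T L) = op_trace S - op_trace T"
  "op_trace (\<lambda>L. - T L) = - op_trace T"
  "op_trace (\<lambda>L. c *\<^sub>R T L) = c * op_trace T"
  by (simp_all add: op_trace_def so_inner_linear sum.distrib sum_subtractf sum_negf
      sum_distrib_left algebra_simps)

lemma op_trace_rank1:
  assumes "X \<in> so_alg" "Y \<in> so_alg"
  shows "op_trace (\<lambda>L. so_inner L X *\<^sub>R Y) = so_inner X Y"
  using parseval_wedge[OF assms] by (simp add: op_trace_def so_inner_linear so_inner_commute[of Y])

text \<open>
  A trace over the subspace \<open>W\<close> is computed without a basis of \<open>W\<close>: composing with the orthogonal
  projection \<open>pr\<close> turns it into a trace over \<open>\<Lambda>\<^sup>2V\<close>, where the standard basis is at hand.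
\<close>

lemma sum_onb_eq_op_trace:
  assumes B: "so_onb W B" and T: "linear T" "\<And>L. L \<in> W \<Longrightarrow> T L \<in> so_alg"
    and pr: "\<And>L. L \<in> so_alg \<Longrightarrow> pr L \<in> W"
      "\<And>L K. L \<in> so_alg \<Longrightarrow> K \<in> W \<Longrightarrow> so_inner (pr L) K = so_inner L K"
  shows "(\<Sum>\<eta>\<in>B. so_inner (T \<eta>) \<eta>) = op_trace (\<lambda>L. T (pr L))"
proof -
  have BW: "B \<subseteq> W" "B \<subseteq> so_alg"
    using B span_superset unfolding so_onb_def so_orthonormal_def by blast+
  have "T (pr L) = (\<Sum>\<eta>\<in>B. so_inner L \<eta> *\<^sub>R T \<eta>)" if "L \<in> so_alg" for L
  proof -
    have "pr L = (\<Sum>\<eta>\<in>B. so_inner (pr L) \<eta> *\<^sub>R \<eta>)"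
      by (rule so_onb_expand[OF B pr(1)[OF that]])
    also have "\<dots> = (\<Sum>\<eta>\<in>B. so_inner L \<eta> *\<^sub>R \<eta>)"
      using pr(2)[OF that] BW by (intro sum.cong) auto
    finally show ?thesis by (simp add: linear_sum[OF T(1)] linear_cmul[OF T(1)])
  qed
  then have "op_trace (\<lambda>L. T (pr L)) =
      (1/2) * (\<Sum>a\<in>Basis. \<Sum>b\<in>Basis. \<Sum>\<eta>\<in>B. so_inner (wedge a b) \<eta> * so_inner (wedge a b) (T \<eta>))"
    by (simp add: op_trace_def wedge_in_so so_inner_sum_left so_inner_linear
        so_inner_commute[of "wedge _ _" "T _"])
  also have "\<dots> = (\<Sum>\<eta>\<in>B. (1/2) * (\<Sum>a\<in>Basis. \<Sum>b\<in>Basis. so_inner (wedge a b) \<eta> * so_inner (wedge a b) (T \<eta>)))"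
    unfolding sum.swap[of _ B] sum_distrib_left ..
  also have "\<dots> = (\<Sum>\<eta>\<in>B. so_inner (T \<eta>) \<eta>)"
    using BW T(2) by (intro sum.cong refl) (subst parseval_wedge, auto simp: so_inner_commute)
  finally show ?thesis by simp
qed

lemma dim_eq_op_trace:
  assumes "subspace W" "W \<subseteq> so_alg"
    and pr: "\<And>L. L \<in> so_alg \<Longrightarrow> pr L \<in> W"
      "\<And>L K. L \<in> so_alg \<Longrightarrow> K \<in> W \<Longrightarrow> so_inner (pr L) K = so_inner L K"
  shows "real (dim W) = op_trace pr"
proof -
  obtain B where B: "so_onb W B"
    using so_onb_extend[OF assms(1,2), of "{}"] by (auto simp: so_orthonormal_def)
  have "(\<Sum>\<eta>\<in>B. so_inner \<eta> \<eta>) = op_trace pr"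
    using sum_onb_eq_op_trace[OF B, of "\<lambda>L. L" pr] pr assms(2) by (auto simp: linear_iff)
  moreover have "(\<Sum>\<eta>\<in>B. so_inner \<eta> \<eta>) = (\<Sum>\<eta>\<in>B. 1)"
    using B by (intro sum.cong) (auto simp: so_onb_def so_orthonormal_def)
  ultimately show ?thesis by (simp add: so_onb_dim[OF B])
qed

text \<open>
  By invariance, \<open>\<parallel>[E, \<eta>]\<parallel>\<^sup>2 = - \<langle>[E, [E, \<eta>]], \<eta>\<rangle>\<close>.
\<close>

lemma casimir_eq_op_trace:
  assumes B: "so_onb W B" and E: "E \<in> so_alg"
    and pr: "\<And>L. L \<in> so_alg \<Longrightarrow> pr L \<in> W"
      "\<And>L K. L \<in> so_alg \<Longrightarrow> K \<in> W \<Longrightarrow> so_inner (pr L) K = so_inner L K"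
  shows "(\<Sum>\<eta>\<in>B. so_inner (bracket E \<eta>) (bracket E \<eta>)) =
    - op_trace (\<lambda>L. bracket E (bracket E (pr L)))"
proof -
  have "so_inner (bracket E \<eta>) (bracket E \<eta>) = - so_inner (bracket E (bracket E \<eta>)) \<eta>" for \<eta>
  proof -
    have "so_inner (bracket E (bracket E \<eta>)) \<eta> = - so_inner (bracket E \<eta>) (bracket E \<eta>)"
      by (subst bracket_swap) (simp add: so_inner_linear so_inner_bracket)
    then show ?thesis by simp
  qed
  then have "(\<Sum>\<eta>\<in>B. so_inner (bracket E \<eta>) (bracket E \<eta>)) =
      - (\<Sum>\<eta>\<in>B. so_inner (bracket E (bracket E \<eta>)) \<eta>)"
    by (simp add: sum_negf)
  also have "(\<Sum>\<eta>\<in>B. so_inner (bracket E (bracket E \<eta>)) \<eta>) =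
      op_trace (\<lambda>L. bracket E (bracket E (pr L)))"
  proof (rule sum_onb_eq_op_trace[OF B _ _ pr])
    show "linear (\<lambda>L. bracket E (bracket E L))"
      using linear_compose[OF linear_bracket_right linear_bracket_right] by (simp add: o_def)
    show "bracket E (bracket E L) \<in> so_alg" if "L \<in> W" for L
      using that so_onb_subset[OF B] by (intro bracket_in_so E) auto
  qed auto
  finally show ?thesis .
qed

text \<open>
  On all endomorphisms \<open>L \<mapsto> X L Y\<close> has trace \<open>tr X tr Y\<close>. Composing with the projection
  \<open>L \<mapsto> (L - L\<^sup>T) / 2\<close> to the skew ones halves this and subtracts half the trace of \<open>L \<mapsto> X L\<^sup>T Y\<close>, which
  is \<open>tr (X\<^sup>T Y)\<close>.
\<close>

lemma op_trace_sandwich: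
  fixes X Y :: "'v::euclidean_space endo"
  shows "op_trace (\<lambda>L. X o\<^sub>L L o\<^sub>L Y) =
    (1/2) * (endo_trace X * endo_trace Y - (\<Sum>b\<in>Basis. blinfun_apply X b \<bullet> blinfun_apply Y b))"
proof -
  define f where "f a b = blinfun_apply (X o\<^sub>L wedge a b o\<^sub>L Y) a \<bullet> b" for a b :: 'v
  \<comment> \<open>\<open>X L Y\<close> need not be skew, so both off-diagonal entries enter.\<close>
  have ip: "so_inner M (wedge a b) = (1/2) * (blinfun_apply M a \<bullet> b - blinfun_apply M b \<bullet> a)"
    for M and a b :: 'v
  proof -
    have "endo_trace (wedge a b o\<^sub>L M) =
        (\<Sum>c\<in>Basis. (a \<bullet> blinfun_apply M c) * (b \<bullet> c)) - (\<Sum>c\<in>Basis. (b \<bullet> blinfun_apply M c) * (a \<bullet> c))"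
      by (simp add: endo_trace_def wedge_apply inner_diff_left sum_subtractf)
    moreover have "(\<Sum>c\<in>Basis. (p \<bullet> blinfun_apply M c) * (q \<bullet> c)) = p \<bullet> blinfun_apply M q" for p q
    proof -
      have "blinfun_apply M q = blinfun_apply M (\<Sum>c\<in>Basis. (q \<bullet> c) *\<^sub>R c)"
        by (simp add: euclidean_representation)
      then show ?thesis
        by (simp add: blinfun.sum_right blinfun.scaleR_right inner_sum_right mult.commute)
    qed
    ultimately have "endo_trace (wedge a b o\<^sub>L M) = a \<bullet> blinfun_apply M b - b \<bullet> blinfun_apply M a"
      by simp
    then show ?thesis
      unfolding so_inner_commute[of M] by (simp add: so_inner_def inner_commute field_simps)
  qed
  have "wedge b a = - wedge a b" for a b :: 'v
    by (rule blinfun_eqI) (simp add: wedge_apply blinfun.minus_left)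
  then have "blinfun_apply (X o\<^sub>L wedge a b o\<^sub>L Y) b \<bullet> a = - f b a" for a b
    by (metis (no_types, lifting) f_def blinfun.minus_left blinfun.minus_right blinfun_apply_blinfun_compose inner_minus_left minus_minus)
  then have entry: "so_inner (X o\<^sub>L wedge a b o\<^sub>L Y) (wedge a b) = (f a b + f b a) / 2" for a b
    unfolding ip by (simp add: f_def)
  have "op_trace (\<lambda>L. X o\<^sub>L L o\<^sub>L Y) =
      (1/4) * ((\<Sum>a\<in>Basis. \<Sum>b\<in>Basis. f a b) + (\<Sum>a\<in>Basis. \<Sum>b\<in>Basis. f b a))"
    by (simp add: op_trace_def entry sum.distrib sum_divide_distrib[symmetric])
  also have "(\<Sum>a\<in>Basis. \<Sum>b\<in>Basis. f b a) = (\<Sum>a\<in>Basis. \<Sum>b\<in>Basis. f a b)"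
    by (rule sum.swap)
  also have "(\<Sum>a\<in>Basis. \<Sum>b\<in>Basis. f a b) =
      (\<Sum>a\<in>Basis. \<Sum>b\<in>Basis. (blinfun_apply Y a \<bullet> a) * (blinfun_apply X b \<bullet> b)) -
      (\<Sum>a\<in>Basis. \<Sum>b\<in>Basis. (blinfun_apply X a \<bullet> b) * (blinfun_apply Y a \<bullet> b))"
    by (simp add: f_def wedge_apply blinfun.diff_right blinfun.scaleR_right inner_diff_left inner_diff_right
        inner_diff_right sum_subtractf inner_commute mult.commute)
  also have "\<dots> = endo_trace X * endo_trace Y - (\<Sum>b\<in>Basis. blinfun_apply X b \<bullet> blinfun_apply Y b)"
    unfolding mult.commute[of "endo_trace X"]
    by (simp add: endo_trace_def sum_product euclidean_inner[symmetric])
  finally show ?thesis by simp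
qed

lemma op_trace_id:
  "op_trace (\<lambda>L :: 'v::euclidean_space endo. L) = (real DIM('v))\<^sup>2 / 2 - real DIM('v) / 2"
proof -
  have "(\<lambda>L :: 'v endo. L) = (\<lambda>L. id_blinfun o\<^sub>L L o\<^sub>L id_blinfun)"
    by (intro ext blinfun_eqI) simp
  then show ?thesis
    by (simp add: op_trace_sandwich endo_trace_def power2_eq_square inner_Basis field_simps)
qed

lemma endo_trace_skew: "S \<in> so_alg \<Longrightarrow> endo_trace S = 0"
  using so_algD[of S] unfolding endo_trace_def
  by (metis (no_types, lifting) equal_neg_zero inner_commute sum.neutral)

lemma op_trace_sandwich_complex_structure:
  fixes S :: "'v::euclidean_space endo"
  assumes S: "S \<in> so_alg" "\<And>x. blinfun_apply S (blinfun_apply S x) = - x"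
  shows "op_trace (\<lambda>L. S o\<^sub>L L o\<^sub>L S) = - (real DIM('v) / 2)"
proof -
  have "blinfun_apply S b \<bullet> blinfun_apply S b = b \<bullet> b" for b
    using so_algD[OF S(1), of b "blinfun_apply S b"] S(2) by simp
  then show ?thesis
    using endo_trace_skew[OF S(1)] by (simp add: op_trace_sandwich inner_Basis)
qed

lemma op_trace_ad_squared_sandwich:
  "op_trace (\<lambda>L. bracket E (bracket E (X o\<^sub>L L o\<^sub>L Y))) =
     op_trace (\<lambda>L. (E o\<^sub>L E o\<^sub>L X) o\<^sub>L L o\<^sub>L Y) - 2 * op_trace (\<lambda>L. (E o\<^sub>L X) o\<^sub>L L o\<^sub>L (Y o\<^sub>L E)) +
     op_trace (\<lambda>L. X o\<^sub>L L o\<^sub>L (Y o\<^sub>L E o\<^sub>L E))"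
proof -
  have "bracket E (bracket E (X o\<^sub>L L o\<^sub>L Y)) =
      (((E o\<^sub>L E o\<^sub>L X) o\<^sub>L L o\<^sub>L Y) - 2 *\<^sub>R ((E o\<^sub>L X) o\<^sub>L L o\<^sub>L (Y o\<^sub>L E))) + (X o\<^sub>L L o\<^sub>L (Y o\<^sub>L E o\<^sub>L E))" for L
    by (rule blinfun_eqI) (simp add: bracket_apply blinfun.add_left blinfun.diff_left
        blinfun.diff_right blinfun.scaleR_left scaleR_2)
  then show ?thesis by (simp add: op_trace_linear)
qed

lemma op_trace_ad_squared:
  fixes E :: "'v::euclidean_space endo"
  assumes E: "E \<in> so_alg" "so_inner E E = 1"
  shows "op_trace (\<lambda>L. bracket E (bracket E L)) = 4 - 2 * real DIM('v)"
proof -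
  have tr: "endo_trace (E o\<^sub>L E) = - 2" using E(2) by (simp add: so_inner_def)
  have sq: "(\<Sum>b\<in>Basis. blinfun_apply E b \<bullet> blinfun_apply E b) = 2"
    using so_inner_eq_sum[OF E(1), of E] E(2) by simp
  have "(\<lambda>L. bracket E (bracket E L)) = (\<lambda>L. bracket E (bracket E (id_blinfun o\<^sub>L L o\<^sub>L id_blinfun)))"
    by (intro ext arg_cong[of _ _ "\<lambda>L. bracket E (bracket E L)"] blinfun_eqI) simp
  moreover have "endo_trace (id_blinfun :: 'v endo) = real DIM('v)"
    by (simp add: endo_trace_def inner_Basis)
  ultimately show ?thesis
    using tr sq endo_trace_skew[OF E(1)]
    by (simp add: op_trace_ad_squared_sandwich op_trace_sandwich endo_trace_def inner_commute)
      (simp add: field_simps)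
qed

text \<open>
  A complex structure \<open>S\<close> that commutes with \<open>E\<close> and is orthogonal to it makes all the terms
  \<open>tr X tr Y\<close> vanish, so the value does not depend on the dimension.
\<close>

lemma op_trace_ad_squared_complex_structure:
  fixes E :: "'v::euclidean_space endo"
  assumes E: "E \<in> so_alg" "so_inner E E = 1"
    and S: "S \<in> so_alg" "\<And>x. blinfun_apply S (blinfun_apply S x) = - x"
    and ES: "\<And>x. blinfun_apply E (blinfun_apply S x) = blinfun_apply S (blinfun_apply E x)"
      "so_inner E S = 0"
  shows "op_trace (\<lambda>L. bracket E (bracket E (S o\<^sub>L L o\<^sub>L S))) = 4"
proof -
  have iso: "blinfun_apply S x \<bullet> blinfun_apply S y = x \<bullet> y" for x y
    using so_algD[OF S(1), of x "blinfun_apply S y"] S(2) by simp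
  have sq: "(\<Sum>b\<in>Basis. blinfun_apply E b \<bullet> blinfun_apply E b) = 2"
    using so_inner_eq_sum[OF E(1), of E] E(2) by simp
  have EE: "blinfun_apply E (blinfun_apply E b) \<bullet> b = - (blinfun_apply E b \<bullet> blinfun_apply E b)"
    "b \<bullet> blinfun_apply E (blinfun_apply E b) = - (blinfun_apply E b \<bullet> blinfun_apply E b)" for b
    using so_algD[OF E(1), of "blinfun_apply E b" b] by (simp_all add: inner_commute)
  have tr: "endo_trace (E o\<^sub>L S) = 0" using ES(2) by (simp add: so_inner_def)
  show ?thesis
    using tr sq by (simp add: op_trace_ad_squared_sandwich op_trace_sandwich
        endo_trace_skew[OF S(1)] ES(1) iso EE sum_negf)
qed


section \<open>Algebraic curvature operators\<close>

lemma alg_curv_combine: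
  assumes "alg_curv S" "alg_curv T"
  shows "alg_curv (\<lambda>L. a *\<^sub>R S L + b *\<^sub>R T L)"
proof -
  have lin: "so_inner (a *\<^sub>R S L + b *\<^sub>R T L) K = a * so_inner (S L) K + b * so_inner (T L) K" for L K
    by (simp add: so_inner_linear)
  have bianchi: "a * p + b * p' + (a * q + b * q') + (a * r + b * r') = 0"
    if "p + q + r = 0" "p' + q' + r' = 0" for p q r p' q' r' :: real
  proof -
    have "a * p + b * p' + (a * q + b * q') + (a * r + b * r') = a * (p + q + r) + b * (p' + q' + r')"
      by (simp add: algebra_simps)
    then show ?thesis using that by simp
  qed
  show ?thesis
    unfolding alg_curv_def curv_tensor_def lin
  proof (intro conjI allI ballI)
    fix L K :: "'a endo" assume LK: "L \<in> so_alg" "K \<in> so_alg"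
    show "a *\<^sub>R S (L + K) + b *\<^sub>R T (L + K) = a *\<^sub>R S L + b *\<^sub>R T L + (a *\<^sub>R S K + b *\<^sub>R T K)"
      using assms LK by (simp add: alg_curv_def scaleR_add_right)
    show "a * so_inner (S L) K + b * so_inner (T L) K = so_inner L (a *\<^sub>R S K + b *\<^sub>R T K)"
      using assms LK by (simp add: alg_curv_def so_inner_linear)
  next
    fix c and L :: "'a endo" assume L: "L \<in> so_alg"
    show "a *\<^sub>R S (c *\<^sub>R L) + b *\<^sub>R T (c *\<^sub>R L) = c *\<^sub>R (a *\<^sub>R S L + b *\<^sub>R T L)"
      using assms L by (simp add: alg_curv_def scaleR_add_right mult.commute)
    show "a *\<^sub>R S L + b *\<^sub>R T L \<in> so_alg"
      using assms L unfolding alg_curv_def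
      by (intro subspace_add[OF subspace_so_alg] subspace_scale[OF subspace_so_alg]) auto
  qed (rule bianchi; use assms in \<open>simp add: alg_curv_def curv_tensor_def\<close>)
qed

lemma alg_curv_id: "alg_curv (\<lambda>L. L)"
  by (simp add: alg_curv_def curv_tensor_def so_inner_wedge_wedge inner_commute)

text \<open>
  On \<open>x \<and> y\<close> this is \<open>1/2 Sx \<and> Sy + \<langle>Sx, y\<rangle> S\<close>, the curvature operator attached to the 2-form \<open>S\<close>. Those
  of \<open>\<complex>\<bbbP>\<^sup>n\<close> and \<open>\<bbbH>\<bbbP>\<^sup>n\<close> are combinations of the identity and such operators.
\<close>

definition skew_curv :: "'v::euclidean_space endo \<Rightarrow> 'v curv_op" where
  "skew_curv S L = so_inner L S *\<^sub>R S - (1/2) *\<^sub>R (S o\<^sub>L L o\<^sub>L S)"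

lemma linear_skew_curv: "linear (skew_curv S)"
  by (rule linearI; rule blinfun_eqI)
    (simp_all add: skew_curv_def so_inner_linear blinfun.add_left blinfun.add_right
      blinfun.diff_left blinfun.scaleR_left blinfun.scaleR_right algebra_simps)

lemma sandwich_wedge:
  assumes "S \<in> so_alg"
  shows "S o\<^sub>L wedge x y o\<^sub>L S = - wedge (blinfun_apply S x) (blinfun_apply S y)"
  by (rule blinfun_eqI)
    (simp add: wedge_apply blinfun.diff_right blinfun.scaleR_right blinfun.minus_left so_algD[OF assms])

lemma alg_curv_skew_curv:
  assumes S: "S \<in> so_alg"
  shows "alg_curv (skew_curv S)"
proof -
  have so: "skew_curv S L \<in> so_alg" if "L \<in> so_alg" for L
    unfolding skew_curv_def
    by (intro subspace_diff[OF subspace_so_alg] subspace_scale[OF subspace_so_alg]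
        so_alg_sandwich S that)
  have sa: "so_inner (skew_curv S L) K = so_inner L (skew_curv S K)" for L K
    by (simp add: skew_curv_def so_inner_linear so_inner_sandwich so_inner_commute[of S])
  have bianchi: "curv_tensor (skew_curv S) x y z w + curv_tensor (skew_curv S) y z x w +
      curv_tensor (skew_curv S) z x y w = 0" for x y z w
  proof -
    have sk: "blinfun_apply S y \<bullet> x = - (blinfun_apply S x \<bullet> y)"
      "blinfun_apply S z \<bullet> x = - (blinfun_apply S x \<bullet> z)"
      "blinfun_apply S z \<bullet> y = - (blinfun_apply S y \<bullet> z)"
      by (metis so_algD[OF S] inner_commute)+
    show ?thesis
      by (simp add: curv_tensor_def skew_curv_def so_inner_linear sandwich_wedge[OF S]
          so_inner_wedge_wedge so_inner_commute[of "wedge _ _" S] so_inner_wedge_right[OF S] sk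
          algebra_simps)
  qed
  show ?thesis
    unfolding alg_curv_def using so sa bianchi linear_add[OF linear_skew_curv] linear_cmul[OF linear_skew_curv] by blast
qed

section \<open>The uniaxial operator on the self-dual forms of a four-dimensional subspace\<close>

text \<open>
  In the quaternions with basis \<open>1, i, j, k\<close>, left multiplication by \<open>i\<close> is \<open>1 \<and> i + j \<and> k\<close>; the
  normalization makes it a unit vector of \<open>so_alg\<close>.
\<close>

definition unit_selfdual :: "'v::euclidean_space \<Rightarrow> 'v \<Rightarrow> 'v \<Rightarrow> 'v \<Rightarrow> 'v endo" where
  "unit_selfdual p q r s = (1 / sqrt 2) *\<^sub>R (wedge p q + wedge r s)"

text \<open>
  On the span of the frame \<open>S\<close> is right multiplication by \<open>i\<close>, which commutes with the left
  multiplications. Cyclic permutation of \<open>e1, e2, e3\<close> permutes the three candidates for \<open>E\<close> and turns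
  \<open>S\<close> into right multiplication by \<open>j\<close> or \<open>k\<close>.
\<close>

lemma unit_selfdual_commute:
  assumes S: "S \<in> so_alg" "blinfun_apply S e0 = e1" "blinfun_apply S e1 = - e0"
      "blinfun_apply S e2 = - e3" "blinfun_apply S e3 = e2"
    and E: "E \<in> {unit_selfdual e0 e1 e2 e3, unit_selfdual e0 e2 e3 e1, unit_selfdual e0 e3 e1 e2}"
  shows "blinfun_apply E (blinfun_apply S x) = blinfun_apply S (blinfun_apply E x)"
proof -
  have sk: "v \<bullet> blinfun_apply S x = - (blinfun_apply S v \<bullet> x)" for v
    using so_algD[OF S(1), of v x] by simp
  show ?thesis
    using E by (auto simp: unit_selfdual_def blinfun.scaleR_left blinfun.add_left wedge_apply sk S
        blinfun.scaleR_right blinfun.diff_right blinfun.add_right)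
qed

definition uniaxial_op :: "'v::euclidean_space endo \<Rightarrow> 'v endo \<Rightarrow> 'v endo \<Rightarrow> 'v curv_op" where
  "uniaxial_op E1 E2 E3 L = (2 * so_inner L E3) *\<^sub>R E3 - so_inner L E1 *\<^sub>R E1 - so_inner L E2 *\<^sub>R E2"

lemma hs_norm_finite_rank:
  assumes "finite I" "\<And>i. i \<in> I \<Longrightarrow> X i \<in> so_alg" "\<And>i. i \<in> I \<Longrightarrow> Y i \<in> so_alg"
    and T: "\<And>L. L \<in> so_alg \<Longrightarrow> T L = (\<Sum>i\<in>I. so_inner L (X i) *\<^sub>R Y i)"
  shows "(hs_norm T)\<^sup>2 = (\<Sum>i\<in>I. \<Sum>j\<in>I. so_inner (X i) (X j) * so_inner (Y i) (Y j))"
proof -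
  define g where "g a b i j =
    so_inner (wedge a b) (X i) * so_inner (wedge a b) (X j) * so_inner (Y i) (Y j)" for a b i j
  have "T (wedge a b) \<in> so_alg" for a b
    unfolding T[OF wedge_in_so]
    by (intro subspace_sum[OF subspace_so_alg] subspace_scale[OF subspace_so_alg] assms)
  then have "(hs_norm T)\<^sup>2 = (1/2) * (\<Sum>a\<in>Basis. \<Sum>b\<in>Basis. so_inner (T (wedge a b)) (T (wedge a b)))"
    by (simp add: hs_norm_def sum_nonneg so_inner_self_nonneg)
  also have "\<dots> = (1/2) * (\<Sum>a\<in>Basis. \<Sum>b\<in>Basis. \<Sum>i\<in>I. \<Sum>j\<in>I. g a b i j)"
    by (simp add: g_def T[OF wedge_in_so] so_inner_sum_left so_inner_sum_right so_inner_linear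
        sum_distrib_left so_inner_commute mult_ac)
  also have "(\<Sum>a\<in>Basis. \<Sum>b\<in>Basis. \<Sum>i\<in>I. \<Sum>j\<in>I. g a b i j) =
      (\<Sum>i\<in>I. \<Sum>j\<in>I. \<Sum>a\<in>Basis. \<Sum>b\<in>Basis. g a b i j)"
    unfolding sum.swap[of _ I Basis] ..
  also have "(1/2) * \<dots> = (\<Sum>i\<in>I. \<Sum>j\<in>I. (1/2) * (\<Sum>a\<in>Basis. \<Sum>b\<in>Basis.
      so_inner (wedge a b) (X i) * so_inner (wedge a b) (X j)) * so_inner (Y i) (Y j))"
    by (simp add: g_def sum_distrib_left sum_distrib_right)
  also have "\<dots> = (\<Sum>i\<in>I. \<Sum>j\<in>I. so_inner (X i) (X j) * so_inner (Y i) (Y j))"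
    using assms by (intro sum.cong refl) (subst parseval_wedge, auto)
  finally show ?thesis .
qed

locale orthonormal_frame =
  fixes e0 e1 e2 e3 :: "'v::euclidean_space"
  assumes unit: "e0 \<bullet> e0 = 1" "e1 \<bullet> e1 = 1" "e2 \<bullet> e2 = 1" "e3 \<bullet> e3 = 1"
    and orth: "e0 \<bullet> e1 = 0" "e0 \<bullet> e2 = 0" "e0 \<bullet> e3 = 0" "e1 \<bullet> e2 = 0" "e1 \<bullet> e3 = 0" "e2 \<bullet> e3 = 0"
begin

definition "E1 = unit_selfdual e0 e1 e2 e3"
definition "E2 = unit_selfdual e0 e2 e3 e1"
definition "E3 = unit_selfdual e0 e3 e1 e2"
definition "Rs = uniaxial_op E1 E2 E3"

lemma orth': "e1 \<bullet> e0 = 0" "e2 \<bullet> e0 = 0" "e3 \<bullet> e0 = 0" "e2 \<bullet> e1 = 0" "e3 \<bullet> e1 = 0" "e3 \<bullet> e2 = 0"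
  using orth by (simp_all add: inner_commute)

lemmas frame_simps = unit orth orth'

lemma E_so: "E1 \<in> so_alg" "E2 \<in> so_alg" "E3 \<in> so_alg"
  unfolding E1_def E2_def E3_def unit_selfdual_def
  by (intro subspace_scale[OF subspace_so_alg] subspace_add[OF subspace_so_alg] wedge_in_so)+

lemma E_orthonormal:
  "so_inner E1 E1 = 1" "so_inner E2 E2 = 1" "so_inner E3 E3 = 1"
  "so_inner E1 E2 = 0" "so_inner E1 E3 = 0" "so_inner E2 E3 = 0"
  "so_inner E2 E1 = 0" "so_inner E3 E1 = 0" "so_inner E3 E2 = 0"
  by (simp_all add: E1_def E2_def E3_def unit_selfdual_def so_inner_linear so_inner_wedge_wedge frame_simps)

lemma E_neq: "E1 \<noteq> E2" "E1 \<noteq> E3" "E2 \<noteq> E3"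
  using E_orthonormal by auto

lemma E_bracket: "bracket E1 E2 = sqrt 2 *\<^sub>R E3" "bracket E2 E3 = sqrt 2 *\<^sub>R E1" "bracket E3 E1 = sqrt 2 *\<^sub>R E2"
  by (rule blinfun_eqI, rule euclidean_eqI,
      simp add: E1_def E2_def E3_def unit_selfdual_def bracket_apply wedge_apply
      frame_simps inner_diff_right inner_add_right inner_diff_left inner_add_left
      blinfun.add_left blinfun.diff_left blinfun.add_right blinfun.diff_right
      blinfun.scaleR_left blinfun.scaleR_right, simp add: field_simps)+

lemma E_bracket_self: "bracket E1 E1 = 0" "bracket E2 E2 = 0" "bracket E3 E3 = 0"
  by (simp_all add: bracket_def)

lemma E_bracket': "bracket E2 E1 = - (sqrt 2 *\<^sub>R E3)" "bracket E3 E2 = - (sqrt 2 *\<^sub>R E1)" "bracket E1 E3 = - (sqrt 2 *\<^sub>R E2)"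
  using E_bracket bracket_swap by metis+

lemma linear_Rs: "linear Rs"
  by (rule linearI) (simp_all add: Rs_def uniaxial_op_def so_inner_linear algebra_simps)

lemma Rs_E: "Rs E1 = - E1" "Rs E2 = - E2" "Rs E3 = 2 *\<^sub>R E3"
  by (simp_all add: Rs_def uniaxial_op_def E_orthonormal)

lemma Rs_orth: "so_inner L E1 = 0 \<Longrightarrow> so_inner L E2 = 0 \<Longrightarrow> so_inner L E3 = 0 \<Longrightarrow> Rs L = 0"
  by (simp add: Rs_def uniaxial_op_def)

lemma Rs_so: "Rs L \<in> so_alg"
  unfolding Rs_def uniaxial_op_def
  by (intro subspace_diff[OF subspace_so_alg] subspace_scale[OF subspace_so_alg] E_so)

lemma op_nonzero_Rs: "op_nonzero Rs"
proof -
  have "E1 \<noteq> 0" using E_orthonormal(1) by (auto simp: so_inner_linear)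
  then show ?thesis
    unfolding op_nonzero_def using E_so(1) by (intro bexI[of _ E1]) (simp_all add: Rs_E)
qed

text \<open>
  The cyclic sum of \<open>\<langle>E x, y\<rangle> \<langle>E z, w\<rangle>\<close> is \<open>(E \<and> E)(x, y, z, w) / 2\<close>, which for each of \<open>E1, E2, E3\<close> is
  the same multiple of the volume form of the frame.
\<close>

lemma alg_curv_Rs: "alg_curv Rs"
proof -
  have bianchi: "curv_tensor Rs x y z w + curv_tensor Rs y z x w + curv_tensor Rs z x y w = 0" for x y z w
    by (simp add: curv_tensor_def Rs_def uniaxial_op_def E1_def E2_def E3_def unit_selfdual_def
        so_inner_linear so_inner_wedge_wedge inner_commute[of _ e0] inner_commute[of _ e1] inner_commute[of _ e2] inner_commute[of _ e3]) (simp add: field_simps)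
  have "so_inner (Rs L) K = so_inner L (Rs K)" for L K
    by (simp add: Rs_def uniaxial_op_def so_inner_linear so_inner_commute[of _ K])
  then show ?thesis
    unfolding alg_curv_def
    using Rs_so bianchi linear_add[OF linear_Rs] linear_cmul[OF linear_Rs] by blast
qed

text \<open>
  The Ricci contraction of \<open>E \<otimes> E\<close> is \<open>\<langle>E x, E y\<rangle>\<close>, and each \<open>E\<^sub>a\<close> is an isometry of the span of the frame
  up to the factor \<open>1 / sqrt 2\<close>.
\<close>

lemma ricci_flat_Rs: "ricci_flat Rs"
proof -
  have p: "(\<Sum>e\<in>Basis. so_inner (wedge x e) E * so_inner E (wedge y e)) =
      blinfun_apply E x \<bullet> blinfun_apply E y" if "E \<in> so_alg" for E and x y :: 'v
    by (simp add: so_inner_commute[of "wedge _ _"] so_inner_wedge_right[OF that] euclidean_inner[symmetric])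
  have q: "blinfun_apply E x \<bullet> blinfun_apply E y =
     ((e0 \<bullet> x) * (e0 \<bullet> y) + (e1 \<bullet> x) * (e1 \<bullet> y) + (e2 \<bullet> x) * (e2 \<bullet> y) + (e3 \<bullet> x) * (e3 \<bullet> y)) / 2"
     if "E = E1 \<or> E = E2 \<or> E = E3" for E x y
    using that by (auto simp: E1_def E2_def E3_def unit_selfdual_def blinfun.scaleR_left blinfun.add_left
        wedge_apply inner_add_left inner_add_right inner_diff_left inner_diff_right frame_simps field_simps)
  have "ricci Rs x y = 2 * (blinfun_apply E3 x \<bullet> blinfun_apply E3 y) -
      blinfun_apply E1 x \<bullet> blinfun_apply E1 y - blinfun_apply E2 x \<bullet> blinfun_apply E2 y" for x y
    unfolding p[OF E_so(1), symmetric] p[OF E_so(2), symmetric] p[OF E_so(3), symmetric]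
    by (simp add: ricci_def curv_tensor_def Rs_def uniaxial_op_def so_inner_linear sum_subtractf
        sum_distrib_left mult.assoc)
  moreover have "blinfun_apply E1 x \<bullet> blinfun_apply E1 y = blinfun_apply E3 x \<bullet> blinfun_apply E3 y"
    "blinfun_apply E2 x \<bullet> blinfun_apply E2 y = blinfun_apply E3 x \<bullet> blinfun_apply E3 y" for x y
    using q[of E1 x y] q[of E2 x y] q[of E3 x y] by simp_all
  ultimately show ?thesis by (simp add: ricci_flat_def)
qed

lemma hs_norm_Rs: "(hs_norm Rs)\<^sup>2 = 6"
proof -
  define X where "X = (!) [E1, E2, E3]"
  define Y where "Y = (!) [- E1, - E2, 2 *\<^sub>R E3]"
  have I: "{..<3::nat} = {0, 1, 2}" by auto
  have "(hs_norm Rs)\<^sup>2 = (\<Sum>i<3. \<Sum>j<3. so_inner (X i) (X j) * so_inner (Y i) (Y j))"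
  proof (rule hs_norm_finite_rank)
    show "X i \<in> so_alg" "Y i \<in> so_alg" if "i \<in> {..<3}" for i
      using that E_so subspace_neg[OF subspace_so_alg] subspace_scale[OF subspace_so_alg]
      unfolding I by (auto simp: X_def Y_def)
    show "Rs L = (\<Sum>i<3. so_inner L (X i) *\<^sub>R Y i)" for L
      unfolding I by (simp add: X_def Y_def Rs_def uniaxial_op_def)
  qed simp
  also have "\<dots> = 6" unfolding I by (simp add: X_def Y_def so_inner_linear E_orthonormal)
  finally show ?thesis .
qed

text \<open>The polar form of \<open>L \<mapsto> \<parallel>L \<cdot> R\<^sub>*\<parallel>\<^sup>2\<close>, as shown by \<open>hs_norm_act_Rs\<close>.\<close>

definition act_form :: "'v endo \<Rightarrow> 'v endo \<Rightarrow> real" where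
  "act_form L K =
     2 * so_inner (bracket E1 L) (bracket E1 K) + 2 * so_inner (bracket E2 L) (bracket E2 K) +
     8 * so_inner (bracket E3 L) (bracket E3 K) +
     16 * (so_inner L E1 * so_inner K E1) + 16 * (so_inner L E2 * so_inner K E2) -
     8 * (so_inner L E3 * so_inner K E3)"

text \<open>
  With \<open>R\<^sub>* = \<Sum>\<^sub>a \<mu>\<^sub>a E\<^sub>a \<otimes> E\<^sub>a\<close> and \<open>F\<^sub>a = [L, E\<^sub>a]\<close>, the derivation rule gives
  \<open>L \<cdot> R\<^sub>* = \<Sum>\<^sub>a \<mu>\<^sub>a (F\<^sub>a \<otimes> E\<^sub>a + E\<^sub>a \<otimes> F\<^sub>a)\<close>. The squares give \<open>2 \<Sum>\<^sub>a \<mu>\<^sub>a\<^sup>2 \<parallel>F\<^sub>a\<parallel>\<^sup>2\<close>; in the cross terms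
  \<open>\<langle>F\<^sub>a, E\<^sub>b\<rangle> = \<langle>L, [E\<^sub>a, E\<^sub>b]\<rangle>\<close> is antisymmetric in \<open>a, b\<close>, and they give \<open>-8 \<mu>\<^sub>a \<mu>\<^sub>b \<langle>L, E\<^sub>c\<rangle>\<^sup>2\<close> for each
  cyclic triple.
\<close>

lemma hs_norm_act_Rs:
  assumes L: "L \<in> so_alg"
  shows "(hs_norm (op_act L Rs))\<^sup>2 = act_form L L"
proof -
  define F1 F2 F3 where "F1 = bracket L E1" and "F2 = bracket L E2" and "F3 = bracket L E3"
  note F = this
  have Fso: "F1 \<in> so_alg" "F2 \<in> so_alg" "F3 \<in> so_alg"
    unfolding F by (intro bracket_in_so L E_so)+
  define X where "X = (!) [E1, F1, E2, F2, E3, F3]"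
  define Y where "Y = (!) [- F1, - E1, - F2, - E2, 2 *\<^sub>R F3, 2 *\<^sub>R E3]"
  have I: "{..<6::nat} = {0, 1, 2, 3, 4, 5}" by auto
  have FE: "so_inner F1 E1 = 0" "so_inner F2 E2 = 0" "so_inner F3 E3 = 0"
    "so_inner F1 E2 = sqrt 2 * so_inner L E3" "so_inner F2 E1 = - (sqrt 2 * so_inner L E3)"
    "so_inner F2 E3 = sqrt 2 * so_inner L E1" "so_inner F3 E2 = - (sqrt 2 * so_inner L E1)"
    "so_inner F3 E1 = sqrt 2 * so_inner L E2" "so_inner F1 E3 = - (sqrt 2 * so_inner L E2)"
    by (simp_all add: F so_inner_bracket E_bracket E_bracket' E_bracket_self so_inner_linear)
  note EF = FE[THEN trans[OF so_inner_commute]]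
  have FF: "so_inner (bracket E1 L) (bracket E1 L) = so_inner F1 F1"
    "so_inner (bracket E2 L) (bracket E2 L) = so_inner F2 F2"
    "so_inner (bracket E3 L) (bracket E3 L) = so_inner F3 F3"
    by (simp_all add: F bracket_swap[of _ L] so_inner_linear)
  have "(hs_norm (op_act L Rs))\<^sup>2 = (\<Sum>i<6. \<Sum>j<6. so_inner (X i) (X j) * so_inner (Y i) (Y j))"
  proof (rule hs_norm_finite_rank)
    show "X i \<in> so_alg" "Y i \<in> so_alg" if "i \<in> {..<6}" for i
      using that E_so Fso subspace_neg[OF subspace_so_alg] subspace_scale[OF subspace_so_alg]
      unfolding I by (auto simp: X_def Y_def)
    have "so_inner (bracket L K) E = - so_inner K (bracket L E)" for K E
      by (simp add: bracket_swap[of L K] so_inner_bracket so_inner_linear)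
    then show "op_act L Rs K = (\<Sum>i<6. so_inner K (X i) *\<^sub>R Y i)" for K
      unfolding I
      by (simp add: X_def Y_def op_act_def Rs_def uniaxial_op_def F linear_diff[OF linear_bracket_right]
          linear_cmul[OF linear_bracket_right] mult.commute)
  qed simp
  also have "\<dots> = act_form L L"
  proof -
    have two: "sqrt 2 * (sqrt 2 * r) = 2 * r" for r by (simp add: mult.assoc[symmetric])
    show ?thesis
      unfolding I act_form_def FF
      by (simp add: X_def Y_def so_inner_linear E_orthonormal FE EF two)
  qed
  finally show ?thesis .
qed

lemma act_form_linear:
  "act_form (L + L') K = act_form L K + act_form L' K" "act_form (a *\<^sub>R L) K = a * act_form L K"
  by (simp_all add: act_form_def linear_add[OF linear_bracket_right] linear_cmul[OF linear_bracket_right]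
      so_inner_linear algebra_simps)

lemma act_form_commute: "act_form L K = act_form K L"
  by (simp add: act_form_def so_inner_commute[of "bracket _ K"] mult.commute)

lemma linear_act_form: "linear (\<lambda>L. act_form L K)" "linear (act_form K)"
proof -
  show 1: "linear (\<lambda>L. act_form L K)" for K by (rule linearI) (simp_all add: act_form_linear)
  have "act_form K = (\<lambda>L. act_form L K)" by (rule ext) (rule act_form_commute)
  then show "linear (act_form K)" using 1 by simp
qed

lemma act_form_E: "act_form E1 E1 = 36" "act_form E2 E2 = 36" "act_form E3 E3 = 0"
  by (simp_all add: act_form_def E_bracket E_bracket' E_bracket_self so_inner_linear E_orthonormal)

section \<open>Partial sums of eigenvalues\<close>

text \<open>
  Every eigenvalue is at least \<open>c - s\<^sub>i\<close>, where \<open>s\<^sub>i = \<langle>\<eta>\<^sub>i, E1\<rangle>\<^sup>2 + \<langle>\<eta>\<^sub>i, E2\<rangle>\<^sup>2\<close>, and Parseval bounds the sum of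
  the \<open>s\<^sub>i\<close> by 2. The argument applies to any ordered eigenbasis, hence to the chosen eigenvalues.
\<close>

lemma Sigma_k_pos:
  assumes W: "W \<subseteq> so_alg" "E1 \<in> W" "E2 \<in> W"
    and ex: "\<exists>\<eta> \<mu>. ordered_eigenbasis W (op_comb c R1 Rs) \<eta> \<mu>"
    and R1: "\<And>L. L \<in> W \<Longrightarrow> so_inner L L \<le> so_inner (R1 L) L"
    and c: "0 < c" "0 < k" "2 < c * k" and k: "k \<le> real (dim W)"
  shows "0 < Sigma_k W (op_comb c R1 Rs) k"
proof -
  define \<mu> where "\<mu> = eigenvals W (op_comb c R1 Rs)"
  obtain \<eta> where eb: "ordered_eigenbasis W (op_comb c R1 Rs) \<eta> \<mu>"
    unfolding \<mu>_def eigenvals_def using someI_ex[of "\<lambda>\<mu>. \<exists>\<eta>. ordered_eigenbasis W (op_comb c R1 Rs) \<eta> \<mu>"] ex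
    by blast
  define s where "s i = (so_inner (\<eta> i) E1)\<^sup>2 + (so_inner (\<eta> i) E2)\<^sup>2" for i
  note onb = ordered_eigenbasis_onb[OF eb W(1)]
  have bound: "c - s i \<le> \<mu> i" if i: "i \<in> {1..dim W}" for i
  proof -
    have h: "\<eta> i \<in> W" "so_inner (\<eta> i) (\<eta> i) = 1" "op_comb c R1 Rs (\<eta> i) = \<mu> i *\<^sub>R \<eta> i"
      using eb i unfolding ordered_eigenbasis_def by auto
    have "\<mu> i = so_inner (op_comb c R1 Rs (\<eta> i)) (\<eta> i)"
      using h by (simp add: so_inner_linear)
    also have "\<dots> = c * so_inner (R1 (\<eta> i)) (\<eta> i) - s i + 2 * (so_inner (\<eta> i) E3)\<^sup>2"
      by (simp add: op_comb_def Rs_def uniaxial_op_def so_inner_linear s_def so_inner_commute[of _ "\<eta> i"]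
          power2_eq_square)
    finally show ?thesis
      using mult_left_mono[OF R1[OF h(1), unfolded h(2)], of c] c(1) zero_le_power2[of "so_inner (\<eta> i) E3"]
      by linarith
  qed
  have "(\<Sum>i=1..dim W. (so_inner (\<eta> i) E)\<^sup>2) = so_inner E E" if "E \<in> W" for E
    using so_onb_parseval[OF onb(1) that, of E]
    by (simp add: sum.reindex[OF onb(2)] power2_eq_square so_inner_commute[of E "\<eta> _"]
        del: One_nat_def)
  then have s_sum: "(\<Sum>i=1..dim W. s i) = 2"
    using W by (simp add: s_def sum.distrib E_orthonormal)
  have s0: "0 \<le> s i" for i by (simp add: s_def)
  define m where "m = nat \<lfloor>k\<rfloor>"
  define t where "t = k - of_int \<lfloor>k\<rfloor>"
  have t: "0 \<le> t" "t < 1" unfolding t_def by linarith+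
  have km: "k = real m + t" using c(2) by (simp add: m_def t_def)
  then have m: "m \<le> dim W" using k t by linarith
  have S: "Sigma_k W (op_comb c R1 Rs) k = (\<Sum>i=1..m. \<mu> i) + t * \<mu> (m + 1)"
    by (simp add: Sigma_k_def \<mu>_def m_def t_def)
  have part: "real m * c - (\<Sum>i=1..m. s i) \<le> (\<Sum>i=1..m. \<mu> i)"
    using sum_mono[of "{1..m}" "\<lambda>i. c - s i" \<mu>] bound m by (simp add: sum_subtractf)
  have "k * c - 2 \<le> (\<Sum>i=1..m. \<mu> i) + t * \<mu> (m + 1)"
    \<comment> \<open>If \<open>m = dim W\<close>, then \<open>\<mu> (m + 1)\<close> is unspecified, but its coefficient \<open>t\<close> is 0.\<close>
  proof (cases "m < dim W")
    case True
    have "(\<Sum>i=1..m. s i) + s (m + 1) = (\<Sum>i=1..m + 1. s i)" by simp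
    also have "\<dots> \<le> (\<Sum>i=1..dim W. s i)"
      using True s0 by (intro sum_mono2) auto
    finally have "(\<Sum>i=1..m. s i) + s (m + 1) \<le> 2" using s_sum by simp
    moreover have "t * s (m + 1) \<le> s (m + 1)"
      using mult_right_mono[of t 1 "s (m + 1)"] t s0 by simp
    moreover have "t * c - t * s (m + 1) \<le> t * \<mu> (m + 1)"
      using mult_left_mono[OF bound[of "m + 1"] t(1)] True by (simp add: right_diff_distrib)
    ultimately show ?thesis using part by (simp add: km algebra_simps)
  next
    case False
    then have "m = dim W" "t = 0" using m k km t by auto
    then show ?thesis using part s_sum by (simp add: km)
  qed
  then show ?thesis using c(3) by (simp add: S mult.commute)
qed

end

section \<open>The uniaxial operator inside a Lie algebra\<close>

text \<open>
  The assumption \<open>casimir\<close> holds with \<open>\<kappa> = h + 1\<close>, where \<open>h\<close> is the dual Coxeter number: \<open>n - 2\<close> for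
  \<open>so(n)\<close>, \<open>n\<close> for \<open>su(n)\<close>, \<open>n + 1\<close> for \<open>sp(n)\<close>.
\<close>

locale frame_in_algebra = orthonormal_frame e0 e1 e2 e3
  for e0 e1 e2 e3 :: "'v::euclidean_space" +
  fixes \<gg> :: "'v endo set" and \<kappa> :: real
  assumes sub: "subspace \<gg>" "\<gg> \<subseteq> so_alg"
    and E_mem: "E1 \<in> \<gg>" "E2 \<in> \<gg>" "E3 \<in> \<gg>"
    and casimir: "\<And>B E. so_onb \<gg> B \<Longrightarrow> E \<in> {E1, E2, E3} \<Longrightarrow>
      (\<Sum>\<eta>\<in>B. so_inner (bracket E \<eta>) (bracket E \<eta>)) = 2 * (\<kappa> - 1)"
begin

lemma sum_act_form:
  assumes B: "so_onb \<gg> B"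
  shows "(\<Sum>\<eta>\<in>B. act_form \<eta> \<eta>) = 24 * \<kappa>"
proof -
  have "(\<Sum>\<eta>\<in>B. so_inner \<eta> E * so_inner \<eta> E) = so_inner E E" if "E \<in> \<gg>" for E
  proof -
    have "so_inner \<eta> E * so_inner \<eta> E = so_inner E \<eta> * so_inner \<eta> E" for \<eta>
      by (simp only: so_inner_commute[of E])
    then show ?thesis using so_onb_parseval[OF B that, of E] by (simp only:)
  qed
  then show ?thesis
    using casimir[OF B] E_mem
    by (simp add: act_form_def sum.distrib sum_subtractf sum_distrib_left[symmetric] E_orthonormal)
qed

lemma onb_with_E: "\<exists>B. so_onb \<gg> B \<and> {E1, E2, E3} \<subseteq> B"
  by (rule so_onb_extend[OF sub])
    (use E_so E_mem E_neq in \<open>auto simp: so_orthonormal_def E_orthonormal\<close>)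

definition Rs_eigenvalue :: "'v endo \<Rightarrow> real" where
  "Rs_eigenvalue L = (if L = E1 \<or> L = E2 then -1 else if L = E3 then 2 else 0)"

lemma Rs_eigen:
  assumes "so_onb W B" "{E1, E2, E3} \<subseteq> B" "L \<in> B"
  shows "Rs L = Rs_eigenvalue L *\<^sub>R L"
proof (cases "L \<in> {E1, E2, E3}")
  case True
  then show ?thesis using E_neq by (auto simp: Rs_eigenvalue_def Rs_E)
next
  case False
  have "so_inner L E = 0" if E: "E \<in> {E1, E2, E3}" for E
  proof -
    have "E \<in> B" "L \<noteq> E" using assms(2) E False by auto
    then show ?thesis using assms(1,3) by (simp add: so_onb_def so_orthonormal_def)
  qed
  then have "Rs L = 0" by (intro Rs_orth) auto
  then show ?thesis using False by (simp add: Rs_eigenvalue_def)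
qed

text \<open>
  The basis is listed as \<open>E1, E2\<close>, then a basis of the kernel of \<open>R\<^sub>*\<close> in \<open>\<gg>\<close>, then \<open>E3\<close>.
\<close>

lemma Rs_eigenbasis:
  "\<exists>\<eta> \<mu>. ordered_eigenbasis \<gg> Rs \<eta> \<mu> \<and>
     (\<forall>l::nat. l = 1 \<or> l = 2 \<longrightarrow>
        (\<Sum>i = 1..l. (hs_norm (op_act (\<eta> i) Rs))\<^sup>2) = 6 * real l * (hs_norm Rs)\<^sup>2)"
proof -
  obtain B where B: "so_onb \<gg> B" "{E1, E2, E3} \<subseteq> B" using onb_with_E by blast
  then obtain rest where rest: "set rest = B - {E1, E2, E3}" "distinct rest"
    using finite_distinct_list[of "B - {E1, E2, E3}"] unfolding so_onb_def by auto
  define bs where "bs = E1 # E2 # rest @ [E3]"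
  have bs: "set bs = B" "distinct bs" using rest B(2) E_neq by (auto simp: bs_def)
  have "map Rs_eigenvalue rest = map (\<lambda>_. 0) rest"
    using rest(1) by (intro map_cong refl) (auto simp: Rs_eigenvalue_def)
  then have "sorted (map Rs_eigenvalue bs)"
    using E_neq by (auto simp: bs_def sorted_append map_replicate_const Rs_eigenvalue_def)
  then have srt: "sort_key Rs_eigenvalue bs = bs" by (rule sort_key_id_if_sorted)
  have two: "{1..2::nat} = {1, 2}" by auto
  have "ordered_eigenbasis \<gg> Rs (\<lambda>i. bs ! (i - 1)) (\<lambda>i. Rs_eigenvalue (bs ! (i - 1)))"
    using so_onb_list_eigenbasis[of \<gg> bs Rs Rs_eigenvalue] B bs Rs_eigen[OF B] by (simp add: srt)
  moreover have "(\<Sum>i = 1..2. (hs_norm (op_act (bs ! (i - 1)) Rs))\<^sup>2) = 72"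
    "(\<Sum>i = 1..1. (hs_norm (op_act (bs ! (i - 1)) Rs))\<^sup>2) = 36"
    unfolding two by (simp_all add: bs_def hs_norm_act_Rs E_so act_form_E)
  ultimately show ?thesis
    by (intro exI conjI allI impI; assumption?) (auto simp: hs_norm_Rs)
qed

lemma R_eigenbasis:
  assumes R1: "\<And>L. L \<in> \<gg> \<Longrightarrow> R1 L = L"
  shows "\<exists>\<eta> \<mu>. ordered_eigenbasis \<gg> (op_comb c R1 Rs) \<eta> \<mu>"
proof -
  obtain B where B: "so_onb \<gg> B" "{E1, E2, E3} \<subseteq> B" using onb_with_E by blast
  then have "B \<subseteq> \<gg>" unfolding so_onb_def using span_superset by blast
  then have "op_comb c R1 Rs L = (c + Rs_eigenvalue L) *\<^sub>R L" if "L \<in> B" for L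
    using R1[of L] Rs_eigen[OF B that] that by (auto simp: op_comb_def scaleR_left_distrib)
  then show ?thesis by (rule ordered_eigenbasis_exists[OF B(1)])
qed

text \<open>
  For an eigenvector, \<open>\<mu>\<^sub>i q(\<eta>\<^sub>i)\<close> is the polar form of \<open>q\<close> at \<open>R \<eta>\<^sub>i\<close> and \<open>\<eta>\<^sub>i\<close>. Expanding
  \<open>R \<eta>\<^sub>i = c \<eta>\<^sub>i + R\<^sub>* \<eta>\<^sub>i\<close> and summing over the basis gives \<open>24 \<kappa> c - q(E1) - q(E2) + 2 q(E3)\<close>, whichever
  eigenbasis is used.
\<close>

lemma Q_form_eq:
  assumes R1: "\<And>L. L \<in> \<gg> \<Longrightarrow> R1 L = L"
  shows "Q_form \<gg> (op_comb c R1 Rs) Rs = 24 * \<kappa> * c - 72"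
proof -
  have "(\<Sum>i = 1..dim \<gg>. \<mu> i * (hs_norm (op_act (\<eta> i) Rs))\<^sup>2) = 24 * \<kappa> * c - 72"
    if eb: "ordered_eigenbasis \<gg> (op_comb c R1 Rs) \<eta> \<mu>" for \<eta> \<mu>
  proof -
    note onb = ordered_eigenbasis_onb[OF eb sub(2)]
    have summand: "\<mu> i * (hs_norm (op_act (\<eta> i) Rs))\<^sup>2 = c * act_form (\<eta> i) (\<eta> i) -
        so_inner E1 (\<eta> i) * act_form E1 (\<eta> i) - so_inner E2 (\<eta> i) * act_form E2 (\<eta> i) +
        2 * (so_inner E3 (\<eta> i) * act_form E3 (\<eta> i))"
      if i: "i \<in> {1..dim \<gg>}" for i
    proof -
      have h: "\<eta> i \<in> \<gg>" "op_comb c R1 Rs (\<eta> i) = \<mu> i *\<^sub>R \<eta> i"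
        using eb i unfolding ordered_eigenbasis_def by auto
      have "\<mu> i * (hs_norm (op_act (\<eta> i) Rs))\<^sup>2 = act_form (op_comb c R1 Rs (\<eta> i)) (\<eta> i)"
        using h(2) hs_norm_act_Rs[OF subsetD[OF sub(2) h(1)]] by (simp add: act_form_linear(2))
      then show ?thesis
        by (simp add: op_comb_def R1[OF h(1)] Rs_def uniaxial_op_def linear_add[OF linear_act_form(1)]
            linear_diff[OF linear_act_form(1)] linear_cmul[OF linear_act_form(1)]
            so_inner_commute[of _ "\<eta> i"])
    qed
    have E: "(\<Sum>i = 1..dim \<gg>. so_inner E (\<eta> i) * act_form E (\<eta> i)) = act_form E E" if "E \<in> \<gg>" for E
      using arg_cong[OF so_onb_expand[OF onb(1) that], of "act_form E"]
      by (simp add: sum.reindex[OF onb(2)] linear_sum[OF linear_act_form(2)]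
          linear_cmul[OF linear_act_form(2)] del: One_nat_def)
    have "(\<Sum>i = 1..dim \<gg>. act_form (\<eta> i) (\<eta> i)) = 24 * \<kappa>"
      using sum_act_form[OF onb(1)] by (simp add: sum.reindex[OF onb(2)] del: One_nat_def)
    then show ?thesis
      using E[OF E_mem(1)] E[OF E_mem(2)] E[OF E_mem(3)]
      by (simp add: summand sum.distrib sum_subtractf sum_distrib_left[symmetric] act_form_E
          del: One_nat_def)
  qed
  moreover obtain \<eta> \<mu> where "(SOME (\<eta>, \<mu>). ordered_eigenbasis \<gg> (op_comb c R1 Rs) \<eta> \<mu>) = (\<eta>, \<mu>)"
    by fastforce
  moreover from this have "ordered_eigenbasis \<gg> (op_comb c R1 Rs) \<eta> \<mu>"
    using R_eigenbasis[OF R1, of c]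
      someI_ex[of "\<lambda>(\<eta>, \<mu>). ordered_eigenbasis \<gg> (op_comb c R1 Rs) \<eta> \<mu>"] by auto
  ultimately show ?thesis
    by (simp add: Q_form_def)
qed

text \<open>
  \<open>Z\<close> is an orthonormal basis of the part of \<open>W\<close> orthogonal to \<open>\<gg>\<close>. That part is zero for \<open>W = \<gg>\<close>, the
  center for \<open>W = u(n)\<close>, and \<open>sp(1)\<close> for \<open>W = sp(n) + sp(1)\<close>.
\<close>

lemma pinched_family:
  assumes Z: "so_orthonormal Z" "finite Z" and orth: "\<And>L K. L \<in> \<gg> \<Longrightarrow> K \<in> Z \<Longrightarrow> so_inner L K = 0"
    and W: "W = span (\<gg> \<union> Z)"
    and R1: "alg_curv R1" "linear R1" "\<And>L. L \<in> \<gg> \<Longrightarrow> R1 L = L"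
      "\<And>L. L \<in> Z \<Longrightarrow> R1 L = a *\<^sub>R L" "1 \<le> a"
    and \<kappa>: "0 < \<kappa>" and k: "2 * \<kappa> / 3 < k" "k \<le> real (dim \<gg> + card Z)"
  shows "2 / k < 3 / \<kappa> \<and> (\<forall>c. 2 / k < c \<and> c < 3 / \<kappa> \<longrightarrow>
    alg_curv (op_comb c R1 Rs) \<and> Sigma_k W (op_comb c R1 Rs) k > 0 \<and> Q_form \<gg> (op_comb c R1 Rs) Rs < 0)"
proof (intro conjI allI impI; (elim conjE)?)
  have k0: "0 < k" using \<kappa> k(1) by (smt (verit) divide_pos_pos)
  show "2 / k < 3 / \<kappa>" using k0 \<kappa> k(1) by (simp add: field_simps)
  obtain B where B: "so_onb \<gg> B" "{E1, E2, E3} \<subseteq> B" using onb_with_E by blast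
  have BZ: "so_onb W (B \<union> Z)" "B \<inter> Z = {}"
    using so_onb_union[OF B(1) Z orth] W by auto
  have Bg: "B \<subseteq> \<gg>" using B(1) span_superset unfolding so_onb_def by blast
  have dimW: "dim W = dim \<gg> + card Z"
    using so_onb_dim[OF BZ(1)] so_onb_dim[OF B(1)] BZ(2) B(1) Z(2)
    by (simp add: card_Un_disjoint so_onb_def)
  define r where "r L = (if L \<in> B then 1 else a)" for L :: "'v endo"
  have r1: "1 \<le> r L" for L using R1(5) by (simp add: r_def)
  have rR1: "R1 L = r L *\<^sub>R L" if "L \<in> B \<union> Z" for L
    using that R1(3,4) Bg BZ(2) by (auto simp: r_def)
  have R1_ge: "so_inner L L \<le> so_inner (R1 L) L" if L: "L \<in> W" for L
  proof -
    have sq: "so_inner L \<eta> * so_inner \<eta> L = (so_inner L \<eta>)\<^sup>2"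
      "so_inner \<eta> L * so_inner L \<eta> = (so_inner L \<eta>)\<^sup>2" for \<eta>
      by (metis power2_eq_square so_inner_commute)+
    have "so_inner (R1 L) L = so_inner (R1 (\<Sum>\<eta>\<in>B \<union> Z. so_inner L \<eta> *\<^sub>R \<eta>)) L"
      by (simp only: so_onb_expand[OF BZ(1) L, symmetric])
    also have "\<dots> = (\<Sum>\<eta>\<in>B \<union> Z. r \<eta> * (so_inner L \<eta>)\<^sup>2)"
      by (simp add: linear_sum[OF R1(2)] linear_cmul[OF R1(2)] so_inner_sum_left so_inner_linear
          rR1 sq mult_ac)
    also have "\<dots> \<ge> (\<Sum>\<eta>\<in>B \<union> Z. 1 * (so_inner L \<eta>)\<^sup>2)"
      by (intro sum_mono mult_right_mono r1) simp
    also have "(\<Sum>\<eta>\<in>B \<union> Z. 1 * (so_inner L \<eta>)\<^sup>2) = so_inner L L"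
      using so_onb_parseval[OF BZ(1) L, of L] by (simp add: sq)
    finally show ?thesis .
  qed
  fix c assume c: "2 / k < c" "c < 3 / \<kappa>"
  show "alg_curv (op_comb c R1 Rs)"
    using alg_curv_combine[OF R1(1) alg_curv_Rs, of c 1] by (simp add: op_comb_def)
  show "Q_form \<gg> (op_comb c R1 Rs) Rs < 0"
    using c(2) \<kappa> by (simp add: Q_form_eq[of R1, OF R1(3)] field_simps)
  have "op_comb c R1 Rs L = (c * r L + Rs_eigenvalue L) *\<^sub>R L" if "L \<in> B \<union> Z" for L
    using rR1[OF that] Rs_eigen[OF BZ(1) _ that] B(2) by (simp add: op_comb_def scaleR_left_distrib le_supI1)
  then have ex: "\<exists>\<eta> \<mu>. ordered_eigenbasis W (op_comb c R1 Rs) \<eta> \<mu>"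
    by (rule ordered_eigenbasis_exists[OF BZ(1)])
  have gW: "\<gg> \<subseteq> W" unfolding W using span_superset by blast
  have "0 < 2 / k" using k0 by simp
  then have "0 < c" using c(1) by linarith
  moreover have "2 < c * k" using c(1) k0 by (simp add: divide_less_eq)
  ultimately show "0 < Sigma_k W (op_comb c R1 Rs) k"
    using k0 k(2) dimW
    by (intro Sigma_k_pos[OF so_onb_subset[OF BZ(1)] subsetD[OF gW E_mem(1)] subsetD[OF gW E_mem(2)] ex R1_ge])
      simp_all
qed

end

section \<open>The real setting\<close>

lemma real_setting:
  assumes "CARD('n::finite) \<ge> 4"
  shows "(let n = real CARD('n); N = n * (n - 1) / 2; \<kappa> = n - 1; kstar = 2 * \<kappa> / 3;
            \<gg> = (so_alg :: (real ^ 'n) endo set)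
        in \<exists>Rs :: (real ^ 'n) curv_op.
             weyl_tensor Rs \<and> op_nonzero Rs \<and>
             (\<exists>\<eta> \<mu>. ordered_eigenbasis \<gg> Rs \<eta> \<mu> \<and>
                (\<forall>l::nat. l = 1 \<or> l = 2 \<longrightarrow>
                   (\<Sum>i = 1..l. (hs_norm (op_act (\<eta> i) Rs))\<^sup>2) = 6 * real l * (hs_norm Rs)\<^sup>2)) \<and>
             (\<forall>k::real. kstar < k \<and> k \<le> N \<longrightarrow>
                2 / k < 3 / \<kappa> \<and>
                (\<forall>c::real. 2 / k < c \<and> c < 3 / \<kappa> \<longrightarrow>
                   alg_curv (op_comb c R1_real Rs) \<and>
                   Sigma_k \<gg> (op_comb c R1_real Rs) k > 0 \<and>
                   Q_form \<gg> (op_comb c R1_real Rs) Rs < 0)))"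
proof -
  obtain h :: "nat \<Rightarrow> 'n" where "bij_betw h {0..<CARD('n)} UNIV"
    using ex_bij_betw_nat_finite[of "UNIV :: 'n set"] by auto
  then have h: "h i = h j \<longleftrightarrow> i = j" if "i < 4" "j < 4" for i j
    using that assms by (auto simp: bij_betw_def inj_on_def)
  interpret F: orthonormal_frame "axis (h 0) 1 :: real ^ 'n" "axis (h 1) 1" "axis (h 2) 1" "axis (h 3) 1"
    by standard (simp_all add: inner_axis_axis h)
  have R1: "R1_real = (\<lambda>L :: (real ^ 'n) endo. L)" by (intro ext) (simp add: R1_real_def)
  have dim: "real (dim (so_alg :: (real ^ 'n) endo set)) = real CARD('n) * (real CARD('n) - 1) / 2"
    using dim_eq_op_trace[OF subspace_so_alg order.refl, of "\<lambda>L :: (real ^ 'n) endo. L"]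
    by (simp add: op_trace_id power2_eq_square algebra_simps)
  interpret G: frame_in_algebra "axis (h 0) 1 :: real ^ 'n" "axis (h 1) 1" "axis (h 2) 1" "axis (h 3) 1"
    so_alg "real CARD('n) - 1"
  proof
    fix B E assume B: "so_onb (so_alg :: (real ^ 'n) endo set) B" "E \<in> {F.E1, F.E2, F.E3}"
    have E: "E \<in> so_alg" "so_inner E E = 1" using B(2) F.E_so F.E_orthonormal by auto
    show "(\<Sum>\<eta>\<in>B. so_inner (bracket E \<eta>) (bracket E \<eta>)) = 2 * (real CARD('n) - 1 - 1)"
      using casimir_eq_op_trace[OF B(1) E(1), of "\<lambda>L. L"] op_trace_ad_squared[OF E] by simp
  qed (rule subspace_so_alg order.refl F.E_so)+
  have "2 / k < 3 / (real CARD('n) - 1) \<and> (\<forall>c. 2 / k < c \<and> c < 3 / (real CARD('n) - 1) \<longrightarrow>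
      alg_curv (op_comb c R1_real F.Rs) \<and> Sigma_k so_alg (op_comb c R1_real F.Rs) k > 0 \<and>
      Q_form so_alg (op_comb c R1_real F.Rs) F.Rs < 0)"
    if "2 * (real CARD('n) - 1) / 3 < k" "k \<le> real CARD('n) * (real CARD('n) - 1) / 2" for k
    by (rule G.pinched_family[where Z = "{}" and a = 1])
      (use that assms dim in \<open>auto simp: so_orthonormal_def R1 alg_curv_id linear_iff
        span_eq_iff[THEN iffD2, OF subspace_so_alg]\<close>)
  moreover have "weyl_tensor F.Rs" 
    unfolding weyl_tensor_def by (intro conjI F.alg_curv_Rs F.ricci_flat_Rs)
  ultimately show ?thesis
    unfolding Let_def using F.op_nonzero_Rs G.Rs_eigenbasis by blast
qed


section \<open>The complex setting\<close>

lemma subspace_u_alg: "subspace (u_alg :: (complex ^ 'n::finite) endo set)"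
  using subspace_so_alg
  by (auto simp: subspace_def u_alg_def blinfun.add_left blinfun.scaleR_left vec_eq_iff algebra_simps)

text \<open>
  The complex trace of a skew endomorphism is imaginary, so one real condition cuts out \<open>su_alg\<close>.
\<close>

lemma su_alg_iff:
  "L \<in> su_alg \<longleftrightarrow> L \<in> u_alg \<and> so_inner L cstruct = 0" for L :: "(complex ^ 'n::finite) endo"
proof -
  have "Re (\<Sum>i\<in>UNIV. blinfun_apply L (axis i 1) $ i) = 0" if "L \<in> u_alg"
  proof -
    have "Re (blinfun_apply L (axis i 1) $ i) = 0" for i
    proof -
      have "blinfun_apply L (axis i 1) \<bullet> axis i 1 = Re (blinfun_apply L (axis i 1) $ i)"
        by (simp add: inner_axis inner_complex_def)
      moreover have "blinfun_apply L (axis i 1) \<bullet> axis i 1 = 0"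
        using that so_algD[of L "axis i 1" "axis i 1"] by (simp add: u_alg_def inner_commute)
      ultimately show ?thesis by simp
    qed
    then show ?thesis by simp
  qed
  then show ?thesis
    by (auto simp: su_alg_def so_inner_cstruct complex_eq_iff)
qed

lemma subspace_su_alg: "subspace (su_alg :: (complex ^ 'n::finite) endo set)"
  using subspace_u_alg by (auto simp: subspace_def su_alg_iff so_inner_linear)

definition su_proj :: "(complex ^ 'n::finite) curv_op" where
  "su_proj L = (1/2) *\<^sub>R (L - (cstruct o\<^sub>L L o\<^sub>L cstruct)) - (so_inner L cstruct / real CARD('n)) *\<^sub>R cstruct"

lemma su_proj:
  assumes "L \<in> so_alg"
  shows "su_proj L \<in> su_alg"
    and "K \<in> su_alg \<Longrightarrow> so_inner (su_proj L) K = so_inner L K"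
proof -
  note u = u_proj_inner[of _ L]
  show "su_proj L \<in> su_alg"
    unfolding su_alg_iff su_proj_def
    using subspace_diff[OF subspace_u_alg u_proj_in_u[OF assms] subspace_scale[OF subspace_u_alg cstruct_in_u]]
      u[OF cstruct_in_u] by (simp add: so_inner_linear(3,7) so_inner_cstruct_self)
  show "so_inner (su_proj L) K = so_inner L K" if "K \<in> su_alg"
    using u[of K] that by (simp add: su_proj_def so_inner_linear(3,7) su_alg_iff so_inner_commute[of cstruct])
qed

lemma cstruct_cstruct: "blinfun_apply cstruct (blinfun_apply cstruct x) = - x"
  by (simp add: cstruct_apply cstruct_twice)

lemma dim_su_alg: "real (dim (su_alg :: (complex ^ 'n::finite) endo set)) = (real CARD('n))\<^sup>2 - 1"
proof -
  have "su_alg \<subseteq> (so_alg :: (complex ^ 'n) endo set)" by (auto simp: su_alg_iff u_alg_def)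
  then have "real (dim (su_alg :: (complex ^ 'n::finite) endo set)) = op_trace (su_proj :: (complex ^ 'n) curv_op)"
    by (rule dim_eq_op_trace[OF subspace_su_alg]) (use su_proj in blast)+
  also have "(su_proj :: (complex ^ 'n) curv_op) = (\<lambda>L. (1/2) *\<^sub>R (L - (cstruct o\<^sub>L L o\<^sub>L cstruct)) -
      (1 / real CARD('n)) *\<^sub>R (so_inner L cstruct *\<^sub>R cstruct))"
    by (rule ext) (simp add: su_proj_def)
  also have "op_trace \<dots> = (real CARD('n))\<^sup>2 - 1"
    unfolding op_trace_linear
    by (simp add: op_trace_id op_trace_rank1 cstruct_in_so so_inner_cstruct_self cstruct_cstruct
        op_trace_sandwich_complex_structure power2_eq_square algebra_simps)
  finally show ?thesis .
qed

lemma casimir_su_alg: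
  assumes B: "so_onb (su_alg :: (complex ^ 'n::finite) endo set) B" and E: "E \<in> su_alg" "so_inner E E = 1"
  shows "(\<Sum>\<eta>\<in>B. so_inner (bracket E \<eta>) (bracket E \<eta>)) = 2 * real CARD('n)"
proof -
  have Eu: "E \<in> u_alg" and Eso: "E \<in> so_alg" and EJ: "so_inner E cstruct = 0"
    using E by (auto simp: su_alg_iff u_alg_def)
  have "bracket E cstruct = 0"
    by (rule blinfun_eqI) (simp add: bracket_apply cstruct_apply u_alg_commute[OF Eu])
  then have "(\<lambda>L. bracket E (bracket E (su_proj L))) = (\<lambda>L. (1/2) *\<^sub>R
      (bracket E (bracket E L) - bracket E (bracket E (cstruct o\<^sub>L L o\<^sub>L cstruct))))"
    by (intro ext) (simp add: su_proj_def linear_diff[OF linear_bracket_right]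
        linear_cmul[OF linear_bracket_right] linear_0[OF linear_bracket_right])
  moreover have "op_trace (\<lambda>L. bracket E (bracket E (cstruct o\<^sub>L L o\<^sub>L cstruct))) = 4"
    using Eso E(2) cstruct_in_so cstruct_cstruct _ EJ
    by (rule op_trace_ad_squared_complex_structure) (simp add: cstruct_apply u_alg_commute[OF Eu])
  ultimately show ?thesis
    using casimir_eq_op_trace[OF B Eso su_proj]
    by (simp add: op_trace_linear op_trace_ad_squared[OF Eso E(2)])
qed

lemma linear_R1_complex: "linear R1_complex"
  and alg_curv_R1_complex: "alg_curv R1_complex"
proof -
  have R1: "R1_complex = (\<lambda>L. (1/2) *\<^sub>R L + 1 *\<^sub>R skew_curv cstruct L)"
    by (rule ext) (simp add: R1_complex_def skew_curv_def scaleR_diff_right)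
  show "linear R1_complex"
    unfolding R1 by (intro linear_compose_add linear_compose_scale_right linear_skew_curv linear_id[unfolded id_def])
  show "alg_curv R1_complex"
    unfolding R1 by (intro alg_curv_combine alg_curv_id alg_curv_skew_curv cstruct_in_so)
qed

lemma u_alg_eq_span:
  "u_alg = span (su_alg \<union> {(1 / sqrt (real CARD('n))) *\<^sub>R (cstruct :: (complex ^ 'n::finite) endo)})"
    (is "_ = span (_ \<union> {?J})")
proof
  show "span (su_alg \<union> {?J}) \<subseteq> u_alg"
    by (rule span_minimal[OF _ subspace_u_alg])
      (auto simp: su_alg_iff intro: subspace_scale[OF subspace_u_alg cstruct_in_u])
  show "u_alg \<subseteq> span (su_alg \<union> {?J})"
  proof
    fix L :: "(complex ^ 'n) endo" assume L: "L \<in> u_alg"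
    define a where "a = so_inner L cstruct / real CARD('n)"
    have "L - a *\<^sub>R cstruct \<in> su_alg"
      using subspace_diff[OF subspace_u_alg L subspace_scale[OF subspace_u_alg cstruct_in_u]]
      by (simp add: su_alg_iff so_inner_linear so_inner_cstruct_self a_def)
    moreover have "(a * sqrt (real CARD('n))) *\<^sub>R ?J \<in> span (su_alg \<union> {?J})"
      by (intro span_scale span_base) simp
    ultimately have "L - a *\<^sub>R cstruct + (a * sqrt (real CARD('n))) *\<^sub>R ?J \<in> span (su_alg \<union> {?J})"
      by (intro span_add) (auto intro: span_base)
    then show "L \<in> span (su_alg \<union> {?J})" by simp
  qed
qed

lemma complex_setting:
  assumes "CARD('n::finite) \<ge> 2"
  shows "(let n = real CARD('n); N = n\<^sup>2 - 1; \<kappa> = n + 1; kstar = 2 * \<kappa> / 3;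
            \<gg> = (su_alg :: (complex ^ 'n) endo set)
        in \<exists>Rs :: (complex ^ 'n) curv_op.
             bochner_tensor Rs \<and> op_nonzero Rs \<and>
             (\<exists>\<eta> \<mu>. ordered_eigenbasis \<gg> Rs \<eta> \<mu> \<and>
                (\<forall>l::nat. l = 1 \<or> l = 2 \<longrightarrow>
                   (\<Sum>i = 1..l. (hs_norm (op_act (\<eta> i) Rs))\<^sup>2) = 6 * real l * (hs_norm Rs)\<^sup>2)) \<and>
             (\<forall>k::real. kstar < k \<and> k \<le> N \<longrightarrow>
                2 / k < 3 / \<kappa> \<and>
                (\<forall>c::real. 2 / k < c \<and> c < 3 / \<kappa> \<longrightarrow>
                   alg_curv (op_comb c R1_complex Rs) \<and>
                   Sigma_k \<gg> (op_comb c R1_complex Rs) k > 0 \<and>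
                   Q_form \<gg> (op_comb c R1_complex Rs) Rs < 0)) \<and>
             (\<forall>k::real. kstar < k \<and> k \<le> N + 1 \<longrightarrow>
                2 / k < 3 / \<kappa> \<and>
                (\<forall>c::real. 2 / k < c \<and> c < 3 / \<kappa> \<longrightarrow>
                   alg_curv (op_comb c R1_complex Rs) \<and>
                   Sigma_k u_alg (op_comb c R1_complex Rs) k > 0 \<and>
                   Q_form \<gg> (op_comb c R1_complex Rs) Rs < 0)))"
proof -
  \<comment> \<open>The sign in the last vector of the frame below makes multiplication by the imaginary unit act as
    right multiplication on the quaternions, hence commute with \<open>E1, E2, E3\<close>.\<close>
  obtain i j :: 'n where ij: "i \<noteq> j"
    using assms by (metis card_2_iff' ex_card UNIV_I)
  let ?e0 = "axis i 1 :: complex ^ 'n" and ?e1 = "axis i \<i>" and ?e2 = "axis j 1" and ?e3 = "axis j (- \<i>)"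
  interpret F: orthonormal_frame ?e0 ?e1 ?e2 ?e3
    by standard (use ij in \<open>simp_all add: inner_axis_axis inner_complex_def\<close>)
  have J: "blinfun_apply cstruct ?e0 = ?e1" "blinfun_apply cstruct ?e1 = - ?e0"
    "blinfun_apply cstruct ?e2 = - ?e3" "blinfun_apply cstruct ?e3 = ?e2"
    by (simp_all add: cstruct_apply vec_eq_iff axis_def)
  have E_su: "E \<in> su_alg" if E: "E \<in> {F.E1, F.E2, F.E3}" for E
  proof -
    have "blinfun_apply E (blinfun_apply cstruct x) = blinfun_apply cstruct (blinfun_apply E x)" for x
      using E by (intro unit_selfdual_commute[OF cstruct_in_so J]) (simp add: F.E1_def F.E2_def F.E3_def)
    then have "E \<in> u_alg" using E F.E_so by (intro u_algI) (auto simp: cstruct_apply)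
    moreover have "so_inner cstruct E = 0"
      using E F.frame_simps by (auto simp: F.E1_def F.E2_def F.E3_def unit_selfdual_def so_inner_linear
          so_inner_wedge_right[OF cstruct_in_so] J)
    ultimately show ?thesis by (simp add: su_alg_iff so_inner_commute[of E])
  qed
  interpret G: frame_in_algebra ?e0 ?e1 ?e2 ?e3 su_alg "real CARD('n) + 1"
  proof
    show "su_alg \<subseteq> so_alg" by (auto simp: su_alg_iff u_alg_def)
    fix B E assume B: "so_onb (su_alg :: (complex ^ 'n) endo set) B" "E \<in> {F.E1, F.E2, F.E3}"
    have "so_inner E E = 1" using B(2) F.E_orthonormal by auto
    then show "(\<Sum>\<eta>\<in>B. so_inner (bracket E \<eta>) (bracket E \<eta>)) = 2 * (real CARD('n) + 1 - 1)"
      using casimir_su_alg[OF B(1) E_su[OF B(2)]] by simp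
  qed (use E_su subspace_su_alg in auto)
  let ?J = "(1 / sqrt (real CARD('n))) *\<^sub>R (cstruct :: (complex ^ 'n) endo)"
  have J1: "so_inner ?J ?J = 1" by (simp add: so_inner_linear so_inner_cstruct_self)
  have bounds: "2 / k < 3 / (real CARD('n) + 1) \<and> (\<forall>c. 2 / k < c \<and> c < 3 / (real CARD('n) + 1) \<longrightarrow>
      alg_curv (op_comb c R1_complex F.Rs) \<and> Sigma_k W (op_comb c R1_complex F.Rs) k > 0 \<and>
      Q_form su_alg (op_comb c R1_complex F.Rs) F.Rs < 0)"
    if "W = span (su_alg \<union> Z)" "Z \<subseteq> {?J}" "2 * (real CARD('n) + 1) / 3 < k" "k \<le> real (dim (su_alg :: (complex ^ 'n) endo set) + card Z)" for k W Z
  proof (rule G.pinched_family[where Z = Z and a = "real CARD('n) + 1"])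
    show "so_orthonormal Z"
      using that(2) J1 subspace_scale[OF subspace_so_alg cstruct_in_so] by (auto simp: so_orthonormal_def)
    show "so_inner L K = 0" if "L \<in> su_alg" "K \<in> Z" for L K
      using that \<open>Z \<subseteq> {?J}\<close> by (auto simp: su_alg_iff so_inner_linear)
    show "R1_complex L = (real CARD('n) + 1) *\<^sub>R L" if "L \<in> Z" for L
      using that \<open>Z \<subseteq> {?J}\<close> by (auto simp: linear_cmul[OF linear_R1_complex] R1_complex_center)
  qed (use that finite_subset in \<open>auto simp: alg_curv_R1_complex linear_R1_complex R1_complex_su\<close>)
  have bochner: "bochner_tensor F.Rs"
    unfolding bochner_tensor_def
  proof (intro conjI ballI)
    fix K :: "(complex ^ 'n) endo" assume "K \<in> so_perp u_alg"
    then have "so_inner K E = 0" if "E \<in> {F.E1, F.E2, F.E3}" for E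
      using E_su[OF that] by (simp add: so_perp_def su_alg_iff)
    then show "F.Rs K = 0" by (intro F.Rs_orth) auto
  qed (rule F.alg_curv_Rs F.ricci_flat_Rs)+
  have su: "2 / k < 3 / (real CARD('n) + 1) \<and> (\<forall>c. 2 / k < c \<and> c < 3 / (real CARD('n) + 1) \<longrightarrow>
      alg_curv (op_comb c R1_complex F.Rs) \<and> Sigma_k su_alg (op_comb c R1_complex F.Rs) k > 0 \<and>
      Q_form su_alg (op_comb c R1_complex F.Rs) F.Rs < 0)"
    if "2 * (real CARD('n) + 1) / 3 < k" "k \<le> (real CARD('n))\<^sup>2 - 1" for k
  proof -
    have "su_alg = span (su_alg \<union> {} :: (complex ^ 'n) endo set)"
      by (simp only: Un_empty_right span_eq_iff[THEN iffD2, OF subspace_su_alg])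
    from bounds[OF this, of k] show ?thesis using that by (simp add: dim_su_alg)
  qed
  have u: "2 / k < 3 / (real CARD('n) + 1) \<and> (\<forall>c. 2 / k < c \<and> c < 3 / (real CARD('n) + 1) \<longrightarrow>
      alg_curv (op_comb c R1_complex F.Rs) \<and> Sigma_k u_alg (op_comb c R1_complex F.Rs) k > 0 \<and>
      Q_form su_alg (op_comb c R1_complex F.Rs) F.Rs < 0)"
    if "2 * (real CARD('n) + 1) / 3 < k" "k \<le> (real CARD('n))\<^sup>2 - 1 + 1" for k
    using bounds[of u_alg "{?J}" k, OF u_alg_eq_span] that by (simp add: dim_su_alg)
  show ?thesis
    unfolding Let_def using bochner F.op_nonzero_Rs G.Rs_eigenbasis su u by blast
qed


section \<open>The quaternionic setting\<close>

lemma subspace_sp_alg: "subspace (sp_alg :: (quat ^ 'n::finite) endo set)"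
  using subspace_so_alg
  by (auto simp: subspace_def sp_alg_def blinfun.add_left blinfun.scaleR_left blinfun.add_right
      blinfun.scaleR_right blinfun.zero_left blinfun.zero_right)

definition sp_proj :: "(quat ^ 'n::finite) curv_op" where
  "sp_proj L = (1/4) *\<^sub>R (L - (Iq o\<^sub>L L o\<^sub>L Iq) - (Jq o\<^sub>L L o\<^sub>L Jq) - (Kq o\<^sub>L L o\<^sub>L Kq))"

lemma sp_proj:
  assumes "L \<in> so_alg"
  shows "sp_proj L \<in> sp_alg"
    and "K \<in> sp_alg \<Longrightarrow> so_inner (sp_proj L) K = so_inner L K"
proof -
  have "sp_proj L \<in> so_alg"
    unfolding sp_proj_def
    by (intro subspace_scale[OF subspace_so_alg] subspace_diff[OF subspace_so_alg]
        so_alg_sandwich assms IJKq_in_so)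
  then show "sp_proj L \<in> sp_alg"
    by (rule sp_algI)
      (simp_all add: sp_proj_def blinfun.diff_left blinfun.diff_right blinfun.scaleR_left
        blinfun.scaleR_right blinfun.minus_right blinfun.minus_left IJKq_apply)
  show "so_inner (sp_proj L) K = so_inner L K" if "K \<in> sp_alg"
    by (simp add: sp_proj_def so_inner_linear so_inner_sandwich sandwich_sp[OF that])
qed

lemma dim_sp_alg:
  "real (dim (sp_alg :: (quat ^ 'n::finite) endo set)) = real CARD('n) * (2 * real CARD('n) + 1)"
proof -
  have "sp_alg \<subseteq> (so_alg :: (quat ^ 'n) endo set)" by (auto simp: sp_alg_def)
  then have "real (dim (sp_alg :: (quat ^ 'n::finite) endo set)) = op_trace (sp_proj :: (quat ^ 'n) curv_op)"
    by (rule dim_eq_op_trace[OF subspace_sp_alg]) (use sp_proj in blast)+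
  also have "(sp_proj :: (quat ^ 'n) curv_op) = (\<lambda>L. (1/4) *\<^sub>R (L - (Iq o\<^sub>L L o\<^sub>L Iq) - (Jq o\<^sub>L L o\<^sub>L Jq) -
      (Kq o\<^sub>L L o\<^sub>L Kq)))"
    by (rule ext) (simp add: sp_proj_def)
  also have "op_trace \<dots> = real CARD('n) * (2 * real CARD('n) + 1)"
    unfolding op_trace_linear
    by (simp add: op_trace_id IJKq_in_so IJKq_apply
        op_trace_sandwich_complex_structure power2_eq_square algebra_simps)
  finally show ?thesis .
qed

lemma casimir_sp_alg:
  assumes B: "so_onb (sp_alg :: (quat ^ 'n::finite) endo set) B" and E: "E \<in> sp_alg" "so_inner E E = 1"
  shows "(\<Sum>\<eta>\<in>B. so_inner (bracket E \<eta>) (bracket E \<eta>)) = 2 * (real CARD('n) + 1)"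
proof -
  have Eso: "E \<in> so_alg" using E by (simp add: sp_alg_def)
  note S = op_trace_ad_squared_complex_structure[OF Eso E(2)]
  have "op_trace (\<lambda>L. bracket E (bracket E (Iq o\<^sub>L L o\<^sub>L Iq))) = 4"
    "op_trace (\<lambda>L. bracket E (bracket E (Jq o\<^sub>L L o\<^sub>L Jq))) = 4"
    "op_trace (\<lambda>L. bracket E (bracket E (Kq o\<^sub>L L o\<^sub>L Kq))) = 4"
    by (intro S IJKq_in_so IJKq_apply sp_alg_commute so_inner_sp_sp1 E(1))+
  moreover have "(\<lambda>L. bracket E (bracket E (sp_proj L))) = (\<lambda>L. (1/4) *\<^sub>R
      (bracket E (bracket E L) - bracket E (bracket E (Iq o\<^sub>L L o\<^sub>L Iq)) -
       bracket E (bracket E (Jq o\<^sub>L L o\<^sub>L Jq)) - bracket E (bracket E (Kq o\<^sub>L L o\<^sub>L Kq))))"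
    by (intro ext) (simp add: sp_proj_def linear_diff[OF linear_bracket_right]
        linear_cmul[OF linear_bracket_right])
  ultimately show ?thesis
    using casimir_eq_op_trace[OF B Eso sp_proj]
    by (simp add: op_trace_linear op_trace_ad_squared[OF Eso E(2)]) (simp add: field_simps)
qed

lemma linear_R1_quat: "linear R1_quat"
  and alg_curv_R1_quat: "alg_curv R1_quat"
proof -
  have R1: "R1_quat = (\<lambda>L. (1/4) *\<^sub>R L + (1/2) *\<^sub>R (1 *\<^sub>R skew_curv Iq L +
      1 *\<^sub>R (1 *\<^sub>R skew_curv Jq L + 1 *\<^sub>R skew_curv Kq L)))"
    by (rule ext) (simp add: R1_quat_def skew_curv_def scaleR_diff_right scaleR_add_right)
  show "linear R1_quat"
    unfolding R1 by (intro linear_compose_add linear_compose_scale_right linear_skew_curv linear_id[unfolded id_def])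
  show "alg_curv R1_quat"
    unfolding R1 by (intro alg_curv_combine alg_curv_id alg_curv_skew_curv IJKq_in_so)
qed

definition sp1_onb :: "(quat ^ 'n::finite) endo set" where
  "sp1_onb = (\<lambda>S. (1 / sqrt (2 * real CARD('n))) *\<^sub>R S) ` {Iq, Jq, Kq}"

lemma sp1_onb:
  shows "so_orthonormal (sp1_onb :: (quat ^ 'n::finite) endo set)"
    and "card (sp1_onb :: (quat ^ 'n::finite) endo set) = 3"
    and "span (sp1_onb :: (quat ^ 'n::finite) endo set) = sp1_alg"
proof -
  define a where "a = 1 / sqrt (2 * real CARD('n))"
  have a: "a \<noteq> 0" "a * a * (2 * real CARD('n)) = 1" by (simp_all add: a_def)
  let ?I = "a *\<^sub>R (Iq :: (quat ^ 'n) endo)" and ?J = "a *\<^sub>R (Jq :: (quat ^ 'n) endo)"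
    and ?K = "a *\<^sub>R (Kq :: (quat ^ 'n) endo)"
  have Z: "sp1_onb = {?I, ?J, ?K}" by (simp add: sp1_onb_def a_def)
  have ip: "so_inner ?I ?I = 1" "so_inner ?J ?J = 1" "so_inner ?K ?K = 1"
    "so_inner ?I ?J = 0" "so_inner ?I ?K = 0" "so_inner ?J ?K = 0"
    "so_inner ?J ?I = 0" "so_inner ?K ?I = 0" "so_inner ?K ?J = 0"
    using a(2) by (simp_all add: so_inner_linear so_inner_IJKq so_inner_commute[of Jq Iq]
        so_inner_commute[of Kq Iq] so_inner_commute[of Kq Jq])
  have ne: "?I \<noteq> ?J" "?I \<noteq> ?K" "?J \<noteq> ?K"
    using ip by (metis zero_neq_one)+
  have so: "?I \<in> so_alg" "?J \<in> so_alg" "?K \<in> so_alg"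
    by (intro subspace_scale[OF subspace_so_alg] IJKq_in_so)+
  show "so_orthonormal (sp1_onb :: (quat ^ 'n::finite) endo set)"
    unfolding so_orthonormal_def Z using ip ne ne[symmetric] so by simp
  show "card (sp1_onb :: (quat ^ 'n::finite) endo set) = 3"
    unfolding Z using ne by simp
  show "span (sp1_onb :: (quat ^ 'n::finite) endo set) = sp1_alg"
  proof
    have "subspace (sp1_alg :: (quat ^ 'n) endo set)"
      unfolding sp1_alg_eq subspace_def
    proof (intro conjI ballI allI; (elim CollectE exE conjE)?)
      show "0 \<in> {x *\<^sub>R Iq + y *\<^sub>R Jq + z *\<^sub>R Kq |x y z. True}"
        by (rule CollectI, intro exI[of _ 0]) simp
      fix L K :: "(quat ^ 'n) endo" and x y z x' y' z' c
      assume LK: "L = x *\<^sub>R Iq + y *\<^sub>R Jq + z *\<^sub>R Kq" "K = x' *\<^sub>R Iq + y' *\<^sub>R Jq + z' *\<^sub>R Kq"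
      show "L + K \<in> {x *\<^sub>R Iq + y *\<^sub>R Jq + z *\<^sub>R Kq |x y z. True}"
        by (rule CollectI, rule exI[of _ "x + x'"], rule exI[of _ "y + y'"], rule exI[of _ "z + z'"])
          (simp add: LK algebra_simps)
    next
      fix c and L :: "(quat ^ 'n) endo" and x y z assume L: "L = x *\<^sub>R Iq + y *\<^sub>R Jq + z *\<^sub>R Kq"
      show "c *\<^sub>R L \<in> {x *\<^sub>R Iq + y *\<^sub>R Jq + z *\<^sub>R Kq |x y z. True}"
        by (rule CollectI, rule exI[of _ "c * x"], rule exI[of _ "c * y"], rule exI[of _ "c * z"])
          (simp add: L algebra_simps)
    qed
    moreover have "Iq \<in> sp1_alg" "Jq \<in> sp1_alg" "Kq \<in> sp1_alg"
      by (force simp: sp1_alg_def Iq_def Jq_def Kq_def)+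
    ultimately have "{?I, ?J, ?K} \<subseteq> sp1_alg" "subspace (sp1_alg :: (quat ^ 'n) endo set)"
      by (auto intro: subspace_scale)
    then show "span sp1_onb \<subseteq> (sp1_alg :: (quat ^ 'n) endo set)"
      unfolding Z by (intro span_minimal)
    show "sp1_alg \<subseteq> span (sp1_onb :: (quat ^ 'n) endo set)"
    proof
      fix L :: "(quat ^ 'n) endo" assume "L \<in> sp1_alg"
      then obtain x y z where L: "L = x *\<^sub>R Iq + y *\<^sub>R Jq + z *\<^sub>R Kq" by (auto simp: sp1_alg_eq)
      have "L = (x / a) *\<^sub>R ?I + (y / a) *\<^sub>R ?J + (z / a) *\<^sub>R ?K" using a(1) by (simp add: L)
      moreover have "\<dots> \<in> span {?I, ?J, ?K}"
        by (intro span_add span_scale span_base) auto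
      ultimately show "L \<in> span sp1_onb" unfolding Z by simp
    qed
  qed
qed

lemma sp_sp1_alg_eq_span: "sp_sp1_alg = span (sp_alg \<union> (sp1_onb :: (quat ^ 'n::finite) endo set))"
  unfolding span_Un span_eq_iff[THEN iffD2, OF subspace_sp_alg] sp1_onb sp_sp1_alg_def by blast

lemma quaternionic_setting:
  assumes "CARD('n::finite) \<ge> 2"
  shows "(let n = real CARD('n); N = n * (2 * n + 1); \<kappa> = n + 2; kstar = 2 * \<kappa> / 3;
            \<gg> = (sp_alg :: (quat ^ 'n) endo set)
        in \<exists>Rs :: (quat ^ 'n) curv_op.
             qweyl_tensor Rs \<and> op_nonzero Rs \<and>
             (\<exists>\<eta> \<mu>. ordered_eigenbasis \<gg> Rs \<eta> \<mu> \<and>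
                (\<forall>l::nat. l = 1 \<or> l = 2 \<longrightarrow>
                   (\<Sum>i = 1..l. (hs_norm (op_act (\<eta> i) Rs))\<^sup>2) = 6 * real l * (hs_norm Rs)\<^sup>2)) \<and>
             (\<forall>k::real. kstar < k \<and> k \<le> N \<longrightarrow>
                2 / k < 3 / \<kappa> \<and>
                (\<forall>c::real. 2 / k < c \<and> c < 3 / \<kappa> \<longrightarrow>
                   alg_curv (op_comb c R1_quat Rs) \<and>
                   Sigma_k \<gg> (op_comb c R1_quat Rs) k > 0 \<and>
                   Q_form \<gg> (op_comb c R1_quat Rs) Rs < 0)) \<and>
             (\<forall>k::real. kstar < k \<and> k \<le> N + 3 \<longrightarrow>
                2 / k < 3 / \<kappa> \<and>
                (\<forall>c::real. 2 / k < c \<and> c < 3 / \<kappa> \<longrightarrow>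
                   alg_curv (op_comb c R1_quat Rs) \<and>
                   Sigma_k sp_sp1_alg (op_comb c R1_quat Rs) k > 0 \<and>
                   Q_form \<gg> (op_comb c R1_quat Rs) Rs < 0)))"
proof -
  \<comment> \<open>The frame is \<open>1, i, j, k\<close> in a single quaternionic coordinate.\<close>
  fix i :: 'n
  let ?e0 = "axis i (1, 0) :: quat ^ 'n" and ?e1 = "axis i (\<i>, 0)" and ?e2 = "axis i (0, 1)"
    and ?e3 = "axis i (0, \<i>)"
  interpret F: orthonormal_frame ?e0 ?e1 ?e2 ?e3
    by standard (simp_all add: inner_axis_axis inner_prod_def inner_complex_def)
  have q: "blinfun_apply (qscale q) (axis i p) = axis i (qmult p q)" for p q
    by (simp add: qscale_apply vec_eq_iff axis_def qmult_def zero_prod_def)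
  have ax: "- axis i p = axis i (- p)" for p :: quat
    by (simp add: vec_eq_iff axis_def)
  have I: "blinfun_apply Iq ?e0 = ?e1" "blinfun_apply Iq ?e1 = - ?e0"
    "blinfun_apply Iq ?e2 = - ?e3" "blinfun_apply Iq ?e3 = ?e2"
    and J: "blinfun_apply Jq ?e0 = ?e2" "blinfun_apply Jq ?e2 = - ?e0"
    "blinfun_apply Jq ?e3 = - ?e1" "blinfun_apply Jq ?e1 = ?e3"
    and K: "blinfun_apply Kq ?e0 = ?e3" "blinfun_apply Kq ?e3 = - ?e0"
    "blinfun_apply Kq ?e1 = - ?e2" "blinfun_apply Kq ?e2 = ?e1"
    by (simp_all add: Iq_def Jq_def Kq_def q ax qmult_def)
  have E_sp: "E \<in> sp_alg" if E: "E \<in> {F.E1, F.E2, F.E3}" for E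
  proof (rule sp_algI)
    show "E \<in> so_alg" using E F.E_so by auto
    show "blinfun_apply E (blinfun_apply Iq x) = blinfun_apply Iq (blinfun_apply E x)"
      "blinfun_apply E (blinfun_apply Jq x) = blinfun_apply Jq (blinfun_apply E x)"
      "blinfun_apply E (blinfun_apply Kq x) = blinfun_apply Kq (blinfun_apply E x)" for x
      using E unit_selfdual_commute[OF IJKq_in_so(1) I, of E x]
        unit_selfdual_commute[OF IJKq_in_so(2) J, of E x] unit_selfdual_commute[OF IJKq_in_so(3) K, of E x]
      by (auto simp: F.E1_def F.E2_def F.E3_def)
  qed
  interpret G: frame_in_algebra ?e0 ?e1 ?e2 ?e3 sp_alg "real CARD('n) + 2"
  proof
    show "sp_alg \<subseteq> so_alg" by (auto simp: sp_alg_def)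
    fix B E assume B: "so_onb (sp_alg :: (quat ^ 'n) endo set) B" "E \<in> {F.E1, F.E2, F.E3}"
    have "so_inner E E = 1" using B(2) F.E_orthonormal by auto
    then show "(\<Sum>\<eta>\<in>B. so_inner (bracket E \<eta>) (bracket E \<eta>)) = 2 * (real CARD('n) + 2 - 1)"
      using casimir_sp_alg[OF B(1) E_sp[OF B(2)]] by simp
  qed (use E_sp subspace_sp_alg in auto)
  have bounds: "2 / k < 3 / (real CARD('n) + 2) \<and> (\<forall>c. 2 / k < c \<and> c < 3 / (real CARD('n) + 2) \<longrightarrow>
      alg_curv (op_comb c R1_quat F.Rs) \<and> Sigma_k W (op_comb c R1_quat F.Rs) k > 0 \<and>
      Q_form sp_alg (op_comb c R1_quat F.Rs) F.Rs < 0)"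
    if W: "W = span (sp_alg \<union> Z)" and Z: "Z = {} \<or> Z = sp1_onb"
      and k: "2 * (real CARD('n) + 2) / 3 < k" "k \<le> real (dim (sp_alg :: (quat ^ 'n) endo set) + card Z)" for k W Z
  proof (rule G.pinched_family[where Z = Z and a = "real CARD('n)"])
    show "so_orthonormal Z" using Z sp1_onb(1) by (auto simp: so_orthonormal_def)
    show "finite Z" using Z by (auto simp: sp1_onb_def)
    show "so_inner L K = 0" if "L \<in> sp_alg" "K \<in> Z" for L K
      using that Z by (auto simp: sp1_onb_def so_inner_linear so_inner_sp_sp1)
    show "R1_quat L = real CARD('n) *\<^sub>R L" if "L \<in> Z" for L
      using that Z sp1_onb(3) span_base[of L sp1_onb] by (auto intro: R1_quat_sp1)
    show "1 \<le> real CARD('n)" using assms by simp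
  qed (use W k in \<open>auto simp: alg_curv_R1_quat linear_R1_quat R1_quat_sp\<close>)
  have qweyl: "qweyl_tensor F.Rs"
    unfolding qweyl_tensor_def
  proof (intro conjI ballI)
    fix K :: "(quat ^ 'n) endo" assume "K \<in> so_perp sp_alg"
    then have "so_inner K E = 0" if "E \<in> {F.E1, F.E2, F.E3}" for E
      using E_sp[OF that] by (simp add: so_perp_def)
    then show "F.Rs K = 0" by (intro F.Rs_orth) auto
  qed (rule F.alg_curv_Rs F.ricci_flat_Rs)+
  have sp: "2 / k < 3 / (real CARD('n) + 2) \<and> (\<forall>c. 2 / k < c \<and> c < 3 / (real CARD('n) + 2) \<longrightarrow>
      alg_curv (op_comb c R1_quat F.Rs) \<and> Sigma_k sp_alg (op_comb c R1_quat F.Rs) k > 0 \<and>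
      Q_form sp_alg (op_comb c R1_quat F.Rs) F.Rs < 0)"
    if "2 * (real CARD('n) + 2) / 3 < k" "k \<le> real CARD('n) * (2 * real CARD('n) + 1)" for k
  proof -
    have "sp_alg = span (sp_alg \<union> {} :: (quat ^ 'n) endo set)"
      by (simp only: Un_empty_right span_eq_iff[THEN iffD2, OF subspace_sp_alg])
    from bounds[OF this, of k] show ?thesis using that by (simp add: dim_sp_alg)
  qed
  have sp_sp1: "2 / k < 3 / (real CARD('n) + 2) \<and> (\<forall>c. 2 / k < c \<and> c < 3 / (real CARD('n) + 2) \<longrightarrow>
      alg_curv (op_comb c R1_quat F.Rs) \<and> Sigma_k sp_sp1_alg (op_comb c R1_quat F.Rs) k > 0 \<and>
      Q_form sp_alg (op_comb c R1_quat F.Rs) F.Rs < 0)"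
    if "2 * (real CARD('n) + 2) / 3 < k" "k \<le> real CARD('n) * (2 * real CARD('n) + 1) + 3" for k
    using bounds[of sp_sp1_alg sp1_onb k, OF sp_sp1_alg_eq_span] that by (simp add: dim_sp_alg sp1_onb(2))
  show ?thesis
    unfolding Let_def using qweyl F.op_nonzero_Rs G.Rs_eigenbasis sp sp_sp1 by blast
qed

section \<open>The sharp examples\<close>

theorem mainTheorem8:
  shows
    "(CARD('n::finite) \<ge> 4 \<longrightarrow>
       (let n = real CARD('n); N = n * (n - 1) / 2; \<kappa> = n - 1; kstar = 2 * \<kappa> / 3;
            \<gg> = (so_alg :: (real ^ 'n) endo set)
        in \<exists>Rs :: (real ^ 'n) curv_op.
             weyl_tensor Rs \<and> op_nonzero Rs \<and>
             (\<exists>\<eta> \<mu>. ordered_eigenbasis \<gg> Rs \<eta> \<mu> \<and>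
                (\<forall>l::nat. l = 1 \<or> l = 2 \<longrightarrow>
                   (\<Sum>i = 1..l. (hs_norm (op_act (\<eta> i) Rs))\<^sup>2) = 6 * real l * (hs_norm Rs)\<^sup>2)) \<and>
             (\<forall>k::real. kstar < k \<and> k \<le> N \<longrightarrow>
                2 / k < 3 / \<kappa> \<and>
                (\<forall>c::real. 2 / k < c \<and> c < 3 / \<kappa> \<longrightarrow>
                   alg_curv (op_comb c R1_real Rs) \<and>
                   Sigma_k \<gg> (op_comb c R1_real Rs) k > 0 \<and>
                   Q_form \<gg> (op_comb c R1_real Rs) Rs < 0))))
   \<and>
     (CARD('n) \<ge> 2 \<longrightarrow>
       (let n = real CARD('n); N = n\<^sup>2 - 1; \<kappa> = n + 1; kstar = 2 * \<kappa> / 3;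
            \<gg> = (su_alg :: (complex ^ 'n) endo set)
        in \<exists>Rs :: (complex ^ 'n) curv_op.
             bochner_tensor Rs \<and> op_nonzero Rs \<and>
             (\<exists>\<eta> \<mu>. ordered_eigenbasis \<gg> Rs \<eta> \<mu> \<and>
                (\<forall>l::nat. l = 1 \<or> l = 2 \<longrightarrow>
                   (\<Sum>i = 1..l. (hs_norm (op_act (\<eta> i) Rs))\<^sup>2) = 6 * real l * (hs_norm Rs)\<^sup>2)) \<and>
             (\<forall>k::real. kstar < k \<and> k \<le> N \<longrightarrow>
                2 / k < 3 / \<kappa> \<and>
                (\<forall>c::real. 2 / k < c \<and> c < 3 / \<kappa> \<longrightarrow>
                   alg_curv (op_comb c R1_complex Rs) \<and>
                   Sigma_k \<gg> (op_comb c R1_complex Rs) k > 0 \<and>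
                   Q_form \<gg> (op_comb c R1_complex Rs) Rs < 0)) \<and>
             (\<forall>k::real. kstar < k \<and> k \<le> N + 1 \<longrightarrow>
                2 / k < 3 / \<kappa> \<and>
                (\<forall>c::real. 2 / k < c \<and> c < 3 / \<kappa> \<longrightarrow>
                   alg_curv (op_comb c R1_complex Rs) \<and>
                   Sigma_k u_alg (op_comb c R1_complex Rs) k > 0 \<and>
                   Q_form \<gg> (op_comb c R1_complex Rs) Rs < 0))))
   \<and>
     (CARD('n) \<ge> 2 \<longrightarrow>
       (let n = real CARD('n); N = n * (2 * n + 1); \<kappa> = n + 2; kstar = 2 * \<kappa> / 3;
            \<gg> = (sp_alg :: (quat ^ 'n) endo set)
        in \<exists>Rs :: (quat ^ 'n) curv_op.
             qweyl_tensor Rs \<and> op_nonzero Rs \<and>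
             (\<exists>\<eta> \<mu>. ordered_eigenbasis \<gg> Rs \<eta> \<mu> \<and>
                (\<forall>l::nat. l = 1 \<or> l = 2 \<longrightarrow>
                   (\<Sum>i = 1..l. (hs_norm (op_act (\<eta> i) Rs))\<^sup>2) = 6 * real l * (hs_norm Rs)\<^sup>2)) \<and>
             (\<forall>k::real. kstar < k \<and> k \<le> N \<longrightarrow>
                2 / k < 3 / \<kappa> \<and>
                (\<forall>c::real. 2 / k < c \<and> c < 3 / \<kappa> \<longrightarrow>
                   alg_curv (op_comb c R1_quat Rs) \<and>
                   Sigma_k \<gg> (op_comb c R1_quat Rs) k > 0 \<and>
                   Q_form \<gg> (op_comb c R1_quat Rs) Rs < 0)) \<and>
             (\<forall>k::real. kstar < k \<and> k \<le> N + 3 \<longrightarrow>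
                2 / k < 3 / \<kappa> \<and>
                (\<forall>c::real. 2 / k < c \<and> c < 3 / \<kappa> \<longrightarrow>
                   alg_curv (op_comb c R1_quat Rs) \<and>
                   Sigma_k sp_sp1_alg (op_comb c R1_quat Rs) k > 0 \<and>
                   Q_form \<gg> (op_comb c R1_quat Rs) Rs < 0))))"
  by (intro conjI impI real_setting complex_setting quaternionic_setting)

end
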